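(* Let $X$ be a connected bridgeless graph with a chosen basepoint $x_0$. Let $A$ be its set of atoms and $i\colon A\to Z_1(X,\mathbb{R})$ the embedding $i(\llbracket\alpha\rrbracket)=\pi(c_\alpha)$. There exists a unique action $\rho$ of the group $\mathrm{Cov}(X)$ as affine transformations of $Z_1(X,\mathbb{R})$ for which $i$ is equivariant, meaning that $$\rho(g)\,i(\llbracket\alpha\rrbracket)=i(g\llbracket\alpha\rrbracket)$$ for all $g\in\mathrm{Cov}(X)$ and $\llbracket\alpha\rrbracket\in A$. Moreover, the transformations $\rho(g)$ are affine isometries.
   Context: Graphs. A graph $X=(E,V,s,t,\mathrm{inv})$ consists of a set $V$ of vertices, a set $E$ of edges, source and target maps $s,t\colon E\to V$, and a map $\mathrm{inv}\colon E\to E$, $e\mapsto e^{-1}$, with $s(e^{-1})=t(e)$, $t(e^{-1})=s(e)$, $(e^{-1})^{-1}=e$ and $e^{-1}\neq e$ for all $e$. Write $e\colon v\to w$ if $s(e)=v$, $t(e)=w$. An edge $e$ is a bridge if removing it (together with $e^{-1}$, which represents the same undirected edge) disconnects the graph; a graph is bridgeless if none of its edges are bridges. A map of graphs is a pair of functions, on vertices and on edges, preserving source, target and inverse; an automorphism is an invertible map of graphs from a graph to itself. Paths. A path $\gamma\colon x\to y$ is a word of edges $\gamma=e_1\cdots e_\ell$ with $e_k\colon v_{k-1}\to v_k$, $v_0=x$, $v_\ell=y$; the empty word is allowed iff $x=y$ (trivial path). Paths are composed by concatenation. A loop based at $x$ is a path $x\to x$. Two paths are homologous if one can be obtained from the other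 by finitely many moves of the following types: introducing or deleting a subword $e e^{-1}$; replacing a subword $\lambda\mu$ by $\mu\lambda$, where $\lambda,\mu$ are loops based at the same vertex. $\llbracket\gamma\rrbracket$ denotes the homology class of $\gamma$. Maximal abelian cover. The vertices of $\overline{X}$, called atoms, are the homology classes $\llbracket\alpha\rrbracket\colon x_0\to x$ of paths starting at $x_0$; $A$ is the set of atoms. The edges of $\overline{X}$ are the pairs $(\llbracket\alpha\rrbracket\colon x_0\to x,\ e\colon x\to y)$, with source $\llbracket\alpha\rrbracket$, target $\llbracket\alpha e\rrbracket$ and inverse $(\llbracket\alpha e\rrbracket,e^{-1})$. The covering map $q\colon\overline{X}\to X$ sends $\llbracket\alpha\rrbracket\colon x_0\to x$ to $x$ and $(\llbracket\alpha\rrbracket,e)$ to $e$. $\mathrm{Cov}(X)$ is the group of automorphisms $g$ of $\overline{X}$ for which there is an automorphism $f$ of $X$ with $q\circ g=f\circ q$; it acts on $A$, the vertex set of $\overline{X}$. Chains. $C_0(X,\mathbb{Z})$ is the free abelian group on $V$; $C_1(X,\mathbb{Z})$ is the free abelian group on $E$ modulo the relations $e^{-1}=-e$; $\partial e=t(e)-s(e)$. $C_k(X,\mathbb{R})=C_k(X,\mathbb{Z})\otimes\mathbb{R}$, and $Z_1(X,\mathbb{R})=\ker(\partial\colon C_1(X,\mathbb{R})\to C_0(X,\mathbb{R}))$. $C_1(X,\mathbb{R})$ has the inner product for which edges form an orthonormal basis (one edge chosen from each pair $\{e,e^{-1}\}$, with $e^{-1}=-e$); $Z_1(X,\mathbb{R})$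 inherits this inner product and the resulting metric, and $\pi\colon C_1(X,\mathbb{R})\to Z_1(X,\mathbb{R})$ is the orthogonal projection. For a path $\gamma=e_1\cdots e_n$, $c_\gamma=e_1+\cdots+e_n$. Homologous paths give the same 1-chain, so $i$ is well-defined. An affine isometry is an affine transformation preserving the metric.
   Formalization: The graph may be infinite, but it is assumed that every chain in C_1(X,R) has an orthogonal projection onto Z_1(X,R), so that π and i are defined; this is automatic for finite graphs and fails, for example, for the two-way infinite ladder. *)

theory Defs
  imports
    "HOL-Analysis.Finite_Function_Topology"
    "HOL-Algebra.Group_Action"
    "Graph_Theory.Graph_Theory"
begin

section \<open>Graphs\<close>

text \<open>
  A graph with edge inversion is a \<^locale>\<open>bidirected_digraph\<close>: multiple edges and loops are
  allowed, nothing is assumed finite, and the inversion \<open>rv\<close> is fixed-point free on the edges.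
  (The locale also normalises \<open>rv\<close> to be the identity outside the edges; this carries no content.)
  Paths are the walks \<^const>\<open>pre_digraph.awalk\<close>.
\<close>

definition bridge :: "('v, 'e) pre_digraph \<Rightarrow> ('e \<Rightarrow> 'e) \<Rightarrow> 'e \<Rightarrow> bool" where
  "bridge G rv e \<longleftrightarrow> e \<in> arcs G \<and>
     \<not> Digraph_Component.connected (pre_digraph.del_arc (pre_digraph.del_arc G e) (rv e))"

definition bridgeless :: "('v, 'e) pre_digraph \<Rightarrow> ('e \<Rightarrow> 'e) \<Rightarrow> bool" where
  "bridgeless G rv \<longleftrightarrow> (\<forall>e. \<not> bridge G rv e)"

definition graph_map ::
  "('v, 'e) pre_digraph \<Rightarrow> ('e \<Rightarrow> 'e) \<Rightarrow> ('w, 'f) pre_digraph \<Rightarrow> ('f \<Rightarrow> 'f)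
     \<Rightarrow> ('v \<Rightarrow> 'w) \<Rightarrow> ('e \<Rightarrow> 'f) \<Rightarrow> bool" where
  "graph_map G rv H rw \<phi> \<psi> \<longleftrightarrow>
     \<phi> \<in> verts G \<rightarrow> verts H \<and> \<psi> \<in> arcs G \<rightarrow> arcs H \<and>
     (\<forall>e\<in>arcs G. tail H (\<psi> e) = \<phi> (tail G e) \<and> head H (\<psi> e) = \<phi> (head G e) \<and>
                 \<psi> (rv e) = rw (\<psi> e))"

text \<open>
  Both components of an automorphism are extensional (\<^const>\<open>Bij\<close>), so that automorphisms are
  equal iff they agree on vertices and edges.
\<close>

definition automorphisms ::
  "('v, 'e) pre_digraph \<Rightarrow> ('e \<Rightarrow> 'e) \<Rightarrow> (('v \<Rightarrow> 'v) \<times> ('e \<Rightarrow> 'e)) set" where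
  "automorphisms G rv =
     {(\<phi>, \<psi>). \<phi> \<in> Bij (verts G) \<and> \<psi> \<in> Bij (arcs G) \<and> graph_map G rv G rv \<phi> \<psi>}"


section \<open>The maximal abelian cover\<close>

text \<open>
  Homology moves between paths starting at \<open>x\<close>. Here \<open>u\<close> and \<open>w\<close> are the unchanged outer parts.
\<close>

inductive homology_move ::
  "('v, 'e) pre_digraph \<Rightarrow> ('e \<Rightarrow> 'e) \<Rightarrow> 'v \<Rightarrow> 'e list \<Rightarrow> 'e list \<Rightarrow> bool"
  for G rv x where
  cancel: "pre_digraph.awalk G x (u @ [e, rv e] @ w) y \<Longrightarrow>
             homology_move G rv x (u @ [e, rv e] @ w) (u @ w)"
| swap: "\<lbrakk>pre_digraph.awalk G x u z; pre_digraph.awalk G z l z; pre_digraph.awalk G z m z;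
           pre_digraph.awalk G z w y\<rbrakk> \<Longrightarrow>
             homology_move G rv x (u @ l @ m @ w) (u @ m @ l @ w)"

definition homologous ::
  "('v, 'e) pre_digraph \<Rightarrow> ('e \<Rightarrow> 'e) \<Rightarrow> 'v \<Rightarrow> 'e list \<Rightarrow> 'e list \<Rightarrow> bool" where
  "homologous G rv x = equivclp (homology_move G rv x)"

definition homology_class ::
  "('v, 'e) pre_digraph \<Rightarrow> ('e \<Rightarrow> 'e) \<Rightarrow> 'v \<Rightarrow> 'e list \<Rightarrow> 'e list set" where
  "homology_class G rv x p = {q. homologous G rv x p q}"

definition atoms :: "('v, 'e) pre_digraph \<Rightarrow> ('e \<Rightarrow> 'e) \<Rightarrow> 'v \<Rightarrow> 'e list set set" where
  "atoms G rv x0 = {homology_class G rv x0 p | p y. pre_digraph.awalk G x0 p y}"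

text \<open>
  Functions on homology classes are defined through representatives: \<^const>\<open>the_elem\<close> picks the
  common value on all representatives. Lemmas \<open>atom_vert_class\<close>, \<open>atom_ext_class\<close> and
  \<open>atom_pos_class\<close> show that there is one.
\<close>

definition atom_vert :: "('v, 'e) pre_digraph \<Rightarrow> 'v \<Rightarrow> 'e list set \<Rightarrow> 'v" where
  "atom_vert G x0 a = the_elem (pre_digraph.awlast G x0 ` a)"

definition atom_ext ::
  "('v, 'e) pre_digraph \<Rightarrow> ('e \<Rightarrow> 'e) \<Rightarrow> 'v \<Rightarrow> 'e list set \<Rightarrow> 'e \<Rightarrow> 'e list set" where
  "atom_ext G rv x0 a e = the_elem ((\<lambda>p. homology_class G rv x0 (p @ [e])) ` a)"

definition cover ::
  "('v, 'e) pre_digraph \<Rightarrow> ('e \<Rightarrow> 'e) \<Rightarrow> 'v \<Rightarrow> ('e list set, 'e list set \<times> 'e) pre_digraph" where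
  "cover G rv x0 =
     \<lparr>verts = atoms G rv x0,
      arcs = {(a, e). a \<in> atoms G rv x0 \<and> e \<in> arcs G \<and> tail G e = atom_vert G x0 a},
      tail = fst,
      head = (\<lambda>(a, e). atom_ext G rv x0 a e)\<rparr>"

definition cover_rev ::
  "('v, 'e) pre_digraph \<Rightarrow> ('e \<Rightarrow> 'e) \<Rightarrow> 'v \<Rightarrow> 'e list set \<times> 'e \<Rightarrow> 'e list set \<times> 'e" where
  "cover_rev G rv x0 d =
     (if d \<in> arcs (cover G rv x0)
      then (atom_ext G rv x0 (fst d) (snd d), rv (snd d)) else d)"

text \<open>
  The covering map is given by \<^const>\<open>atom_vert\<close> on vertices and \<^const>\<open>snd\<close> on edges.
\<close>

definition Cov ::
  "('v, 'e) pre_digraph \<Rightarrow> ('e \<Rightarrow> 'e) \<Rightarrow> 'v \<Rightarrow>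
     (('e list set \<Rightarrow> 'e list set) \<times> ('e list set \<times> 'e \<Rightarrow> 'e list set \<times> 'e)) monoid" where
  "Cov G rv x0 =
     (BijGroup (verts (cover G rv x0)) \<times>\<times> BijGroup (arcs (cover G rv x0)))
       \<lparr>carrier := {(\<phi>, \<psi>). (\<phi>, \<psi>) \<in> automorphisms (cover G rv x0) (cover_rev G rv x0) \<and>
          (\<exists>(fv, fe)\<in>automorphisms G rv.
             (\<forall>a\<in>verts (cover G rv x0). atom_vert G x0 (\<phi> a) = fv (atom_vert G x0 a)) \<and>
             (\<forall>d\<in>arcs (cover G rv x0). snd (\<psi> d) = fe (snd d)))}\<rparr>"


section \<open>Chains\<close>

text \<open>
  A real 1-chain is represented by its finitely supported coefficient function, extended to all
  edges by \<open>c (rv e) = - c e\<close>. The generator \<open>e\<close> is \<open>edge_chain rv e\<close>, so that \<open>rv e = - e\<close>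
  in the chain space. Every sum over undirected edges appears as half the sum over all edges.
\<close>

definition C1 :: "('v, 'e) pre_digraph \<Rightarrow> ('e \<Rightarrow> 'e) \<Rightarrow> ('e \<Rightarrow>\<^sub>0 real) set" where
  "C1 G rv = {c. Poly_Mapping.keys c \<subseteq> arcs G \<and>
     (\<forall>e\<in>arcs G. Poly_Mapping.lookup c (rv e) = - Poly_Mapping.lookup c e)}"

definition edge_chain :: "('e \<Rightarrow> 'e) \<Rightarrow> 'e \<Rightarrow> ('e \<Rightarrow>\<^sub>0 real)" where
  "edge_chain rv e = Poly_Mapping.single e 1 - Poly_Mapping.single (rv e) 1"

definition path_chain :: "('e \<Rightarrow> 'e) \<Rightarrow> 'e list \<Rightarrow> ('e \<Rightarrow>\<^sub>0 real)" where
  "path_chain rv p = (\<Sum>e\<leftarrow>p. edge_chain rv e)"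

definition boundary :: "('v, 'e) pre_digraph \<Rightarrow> ('e \<Rightarrow>\<^sub>0 real) \<Rightarrow> ('v \<Rightarrow>\<^sub>0 real)" where
  "boundary G c = (\<Sum>e\<in>Poly_Mapping.keys c. (Poly_Mapping.lookup c e / 2) *\<^sub>R
     (Poly_Mapping.single (head G e) 1 - Poly_Mapping.single (tail G e) 1))"

definition Z1 :: "('v, 'e) pre_digraph \<Rightarrow> ('e \<Rightarrow> 'e) \<Rightarrow> ('e \<Rightarrow>\<^sub>0 real) set" where
  "Z1 G rv = {c \<in> C1 G rv. boundary G c = 0}"

definition chain_inner :: "('e \<Rightarrow>\<^sub>0 real) \<Rightarrow> ('e \<Rightarrow>\<^sub>0 real) \<Rightarrow> real" where
  "chain_inner c d =
     (\<Sum>e\<in>Poly_Mapping.keys c. Poly_Mapping.lookup c e * Poly_Mapping.lookup d e) / 2"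

text \<open>
  This is not \<^const>\<open>dist\<close>, which on finitely supported functions is the sum of the absolute
  differences of the values.
\<close>

definition chain_dist :: "('e \<Rightarrow>\<^sub>0 real) \<Rightarrow> ('e \<Rightarrow>\<^sub>0 real) \<Rightarrow> real" where
  "chain_dist c d = sqrt (chain_inner (c - d) (c - d))"

definition is_cycle_proj ::
  "('v, 'e) pre_digraph \<Rightarrow> ('e \<Rightarrow> 'e) \<Rightarrow> ('e \<Rightarrow>\<^sub>0 real) \<Rightarrow> ('e \<Rightarrow>\<^sub>0 real) \<Rightarrow> bool" where
  "is_cycle_proj G rv c z \<longleftrightarrow> z \<in> Z1 G rv \<and> (\<forall>w\<in>Z1 G rv. chain_inner (c - z) w = 0)"

definition cycle_proj ::
  "('v, 'e) pre_digraph \<Rightarrow> ('e \<Rightarrow> 'e) \<Rightarrow> ('e \<Rightarrow>\<^sub>0 real) \<Rightarrow> ('e \<Rightarrow>\<^sub>0 real)" where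
  "cycle_proj G rv c = (THE z. is_cycle_proj G rv c z)"

text \<open>
  The orthogonal projection onto the cycles is defined on all chains. This holds for every graph
  with finitely many edges (lemma \<open>has_cycle_proj_finite\<close>). For infinite graphs, \<open>Z1\<close> need not
  have an orthogonal complement in \<open>C1\<close>: in the two-way infinite ladder a rung has no orthogonal
  projection onto the finitely supported cycles.
\<close>

definition has_cycle_proj :: "('v, 'e) pre_digraph \<Rightarrow> ('e \<Rightarrow> 'e) \<Rightarrow> bool" where
  "has_cycle_proj G rv \<longleftrightarrow> (\<forall>c\<in>C1 G rv. \<exists>z. is_cycle_proj G rv c z)"

definition atom_pos ::
  "('v, 'e) pre_digraph \<Rightarrow> ('e \<Rightarrow> 'e) \<Rightarrow> 'e list set \<Rightarrow> ('e \<Rightarrow>\<^sub>0 real)" where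
  "atom_pos G rv a = the_elem ((\<lambda>p. cycle_proj G rv (path_chain rv p)) ` a)"


section \<open>Affine actions\<close>

definition linear_map_on :: "'a::real_vector set \<Rightarrow> ('a \<Rightarrow> 'a) \<Rightarrow> bool" where
  "linear_map_on S L \<longleftrightarrow> L \<in> S \<rightarrow> S \<and>
     (\<forall>x\<in>S. \<forall>y\<in>S. L (x + y) = L x + L y) \<and> (\<forall>r. \<forall>x\<in>S. L (r *\<^sub>R x) = r *\<^sub>R L x)"

definition affine_transformation :: "'a::real_vector set \<Rightarrow> ('a \<Rightarrow> 'a) \<Rightarrow> bool" where
  "affine_transformation S T \<longleftrightarrow> T \<in> Bij S \<and>
     (\<exists>L. linear_map_on S L \<and> (\<exists>b\<in>S. \<forall>x\<in>S. T x = L x + b))"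

definition affine_isometry :: "('e \<Rightarrow>\<^sub>0 real) set \<Rightarrow> (('e \<Rightarrow>\<^sub>0 real) \<Rightarrow> ('e \<Rightarrow>\<^sub>0 real)) \<Rightarrow> bool" where
  "affine_isometry S T \<longleftrightarrow> affine_transformation S T \<and>
     (\<forall>x\<in>S. \<forall>y\<in>S. chain_dist (T x) (T y) = chain_dist x y)"

text \<open>
  Actions are extensional on the carrier of the group, so that they are equal iff all group
  elements act equally.
\<close>

definition affine_action ::
  "('g, 'm) monoid_scheme \<Rightarrow> 'a::real_vector set \<Rightarrow> ('g \<Rightarrow> 'a \<Rightarrow> 'a) \<Rightarrow> bool" where
  "affine_action \<Gamma> S \<rho> \<longleftrightarrow> \<rho> \<in> extensional (carrier \<Gamma>) \<and> group_action \<Gamma> S \<rho> \<and>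
     (\<forall>g\<in>carrier \<Gamma>. affine_transformation S (\<rho> g))"

definition equivariant_affine_action ::
  "('v, 'e) pre_digraph \<Rightarrow> ('e \<Rightarrow> 'e) \<Rightarrow> 'v \<Rightarrow>
     (('e list set \<Rightarrow> 'e list set) \<times> ('e list set \<times> 'e \<Rightarrow> 'e list set \<times> 'e)
        \<Rightarrow> ('e \<Rightarrow>\<^sub>0 real) \<Rightarrow> ('e \<Rightarrow>\<^sub>0 real)) \<Rightarrow> bool" where
  "equivariant_affine_action G rv x0 \<rho> \<longleftrightarrow>
     affine_action (Cov G rv x0) (Z1 G rv) \<rho> \<and>
     (\<forall>g\<in>carrier (Cov G rv x0). \<forall>a\<in>atoms G rv x0.
        \<rho> g (atom_pos G rv a) = atom_pos G rv (fst g a))"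


section \<open>The definitions behave as intended\<close>

context bidirected_digraph
begin

lemma homology_move_invariants:
  assumes "homology_move G arev x p q"
  shows "awalk x p y \<longleftrightarrow> awalk x q y" and "path_chain arev p = path_chain arev q"
  using assms
proof (induction rule: homology_move.induct)
  case (cancel u e w z)
  {
    case 1
    have "e \<in> arcs G" using cancel by (auto simp: awalk_simps)
    then show ?case using cancel by (auto simp: awalk_simps)
  next
    case 2
    show ?case by (simp add: path_chain_def edge_chain_def)
  }
next
  case (swap u z l m w y')
  {
    case 1
    show ?case using swap by (auto simp: awalk_simps)
  next
    case 2
    show ?case by (simp add: path_chain_def add.commute add.left_commute)
  }
qed

lemma homologous_invariants:
  assumes "homologous G arev x p q"
  shows "(awalk x p y \<longleftrightarrow> awalk x q y) \<and> path_chain arev p = path_chain arev q"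
  using assms unfolding homologous_def
proof (induction rule: equivclp_induct)
  case base
  show ?case by simp
next
  case (step q r)
  then show ?case
    using homology_move_invariants(1)[of x q r y] homology_move_invariants(1)[of x r q y]
      homology_move_invariants(2)[of x q r] homology_move_invariants(2)[of x r q]
    by auto
qed

lemma homologous_awalk: "homologous G arev x p q \<Longrightarrow> awalk x p y \<Longrightarrow> awalk x q y"
  using homologous_invariants by blast

lemma homologous_path_chain: "homologous G arev x p q \<Longrightarrow> path_chain arev p = path_chain arev q"
  using homologous_invariants by blast

lemma homologous_refl: "homologous G arev x p p"
  by (simp add: homologous_def)

lemma homology_class_eq:
  "homologous G arev x p q \<Longrightarrow> homology_class G arev x p = homology_class G arev x q"
  unfolding homology_class_def homologous_def
  by (auto intro: equivclp_sym equivclp_trans)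

lemma homology_class_eq_iff:
  "homology_class G arev x p = homology_class G arev x q \<longleftrightarrow> homologous G arev x p q"
  using homology_class_eq homologous_refl unfolding homology_class_def by blast

lemma the_elem_const: "A \<noteq> {} \<Longrightarrow> (\<And>x. x \<in> A \<Longrightarrow> f x = c) \<Longrightarrow> the_elem (f ` A) = c"
  by (metis image_cong image_constant_conv the_elem_eq)

lemma class_nonempty: "homology_class G arev x p \<noteq> {}"
  using homologous_refl by (auto simp: homology_class_def)

lemma atom_vert_class:
  assumes "awalk x0 p y"
  shows "atom_vert G x0 (homology_class G arev x0 p) = y"
  unfolding atom_vert_def
proof (rule the_elem_const[OF class_nonempty])
  fix q assume "q \<in> homology_class G arev x0 p"
  then have "homologous G arev x0 p q" by (simp add: homology_class_def)
  then have "awalk x0 q y" using assms by (rule homologous_awalk)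
  then show "awlast x0 q = y" by simp
qed

lemma homology_move_append:
  assumes "homology_move G arev x p q" "awalk x p y" "e \<in> arcs G" "tail G e = y"
  shows "homology_move G arev x (p @ [e]) (q @ [e])"
proof -
  have e: "awalk y [e] (head G e)" using assms(3,4) arc_implies_awalk by blast
  from assms(1,2) show ?thesis
  proof (induction rule: homology_move.induct)
    case (cancel u d w z)
    have "awalk x (u @ [d, arev d] @ (w @ [e])) (head G e)"
      using awalk_appendI[OF cancel.prems e] by (simp only: append_assoc)
    from homology_move.cancel[where rv = arev, OF this] show ?case
      by (simp only: append_assoc)
  next
    case (swap u z l m w y')
    have "awalk x (u @ l @ m @ w) y'" using swap.hyps by (blast intro: awalk_appendI)
    from awalk_ends[OF this swap.prems] have "y' = y" by blast
    then have "awalk z (w @ [e]) (head G e)" using awalk_appendI[OF swap.hyps(4)] e by simp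
    from homology_move.swap[where rv = arev, OF swap.hyps(1-3) this] show ?case
      by (simp only: append_assoc)
  qed
qed

lemma homologous_append:
  assumes "homologous G arev x p q" "awalk x p y" "e \<in> arcs G" "tail G e = y"
  shows "homologous G arev x (p @ [e]) (q @ [e])"
  using assms(1) unfolding homologous_def
proof (induction rule: equivclp_induct)
  case base
  show ?case by simp
next
  case (step q r)
  have "homologous G arev x p q" "homologous G arev x p r"
    using step(1) equivclp_into_equivclp[OF step(1,2)] unfolding homologous_def by auto
  then have "awalk x q y" "awalk x r y" using homologous_awalk assms(2) by blast+
  then have "homology_move G arev x (q @ [e]) (r @ [e]) \<or> homology_move G arev x (r @ [e]) (q @ [e])"
    using step(2) homology_move_append assms(3,4) by blast
  then show ?case by (rule equivclp_into_equivclp[OF step(3)])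
qed

lemma atom_ext_class:
  assumes "awalk x0 p (tail G e)" "e \<in> arcs G"
  shows "atom_ext G arev x0 (homology_class G arev x0 p) e = homology_class G arev x0 (p @ [e])"
  unfolding atom_ext_def
proof (rule the_elem_const[OF class_nonempty])
  fix q assume "q \<in> homology_class G arev x0 p"
  then have "homologous G arev x0 p q" by (simp add: homology_class_def)
  then have "homologous G arev x0 (p @ [e]) (q @ [e])"
    using assms by (intro homologous_append) auto
  then show "homology_class G arev x0 (q @ [e]) = homology_class G arev x0 (p @ [e])"
    by (rule homology_class_eq[symmetric])
qed

lemma atom_pos_class:
  "atom_pos G arev (homology_class G arev x0 p) = cycle_proj G arev (path_chain arev p)"
  unfolding atom_pos_def
proof (rule the_elem_const[OF class_nonempty])
  fix q assume "q \<in> homology_class G arev x0 p"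
  then have "homologous G arev x0 p q" by (simp add: homology_class_def)
  from homologous_path_chain[OF this]
  show "cycle_proj G arev (path_chain arev q) = cycle_proj G arev (path_chain arev p)" by simp
qed

lemma bidirected_cover: "bidirected_digraph (cover G arev x0) (cover_rev G arev x0)"
proof -
  let ?C = "cover G arev x0"
  have *: "\<exists>p. a = homology_class G arev x0 p \<and> awalk x0 p (tail G e) \<and> e \<in> arcs G"
    if "(a, e) \<in> arcs ?C" for a e
  proof -
    have ae: "e \<in> arcs G" "tail G e = atom_vert G x0 a" "a \<in> atoms G arev x0"
      using that by (simp_all add: cover_def)
    then obtain p y where p: "a = homology_class G arev x0 p" "awalk x0 p y"
      unfolding atoms_def by blast
    with ae(2) atom_vert_class[OF p(2)] have "tail G e = y" by (simp only:)
    with p ae(1) show ?thesis by blast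
  qed
  have ext: "atom_ext G arev x0 a e \<in> atoms G arev x0 \<and>
      (atom_ext G arev x0 a e, arev e) \<in> arcs ?C \<and>
      atom_ext G arev x0 (atom_ext G arev x0 a e) (arev e) = a" if ae: "(a, e) \<in> arcs ?C" for a e
  proof -
    obtain p where p: "a = homology_class G arev x0 p" "awalk x0 p (tail G e)" "e \<in> arcs G"
      using *[OF ae] by blast
    have w: "awalk x0 (p @ [e]) (head G e)"
      using awalk_appendI[OF p(2) arc_implies_awalk[OF p(3)]] .
    have e1: "atom_ext G arev x0 a e = homology_class G arev x0 (p @ [e])"
      using p atom_ext_class by simp
    have e2: "atom_ext G arev x0 (homology_class G arev x0 (p @ [e])) (arev e)
        = homology_class G arev x0 ((p @ [e]) @ [arev e])"
      using p w by (intro atom_ext_class) auto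
    have "awalk x0 (p @ [e, arev e] @ []) (tail G e)"
      using awalk_appendI[OF w, of "[arev e]"] arc_implies_awalk[of "arev e"] p(3) by simp
    then have "homology_move G arev x0 (p @ [e, arev e] @ []) (p @ [])"
      by (rule homology_move.cancel)
    then have "homologous G arev x0 (p @ [e, arev e]) p"
      unfolding homologous_def by auto
    from homology_class_eq[OF this]
    have "atom_ext G arev x0 (atom_ext G arev x0 a e) (arev e) = a"
      using e1 e2 p(1) by simp
    moreover have "atom_ext G arev x0 a e \<in> atoms G arev x0"
      unfolding e1 atoms_def using w by blast
    moreover have "tail G (arev e) = atom_vert G x0 (atom_ext G arev x0 a e)"
      unfolding e1 atom_vert_class[OF w] using p(3) by simp
    ultimately show ?thesis
      using p(3) by (simp add: cover_def)
  qed
  interpret C: wf_digraph ?C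
    using ext by unfold_locales (auto simp: cover_def)
  show ?thesis
    by (rule C.bidirected_digraphI)
      (use ext in \<open>auto simp: cover_rev_def split: if_splits\<close>,
       auto simp: cover_def dest: arev_neq)
qed

subsection \<open>Edges generate the chains and are orthonormal\<close>

lemma edge_chain_C1: "e \<in> arcs G \<Longrightarrow> edge_chain arev e \<in> C1 G arev"
  by (auto simp: C1_def edge_chain_def lookup_minus lookup_single when_def in_keys_iff
           split: if_splits dest: arev_neq)
    (metis arev_arev)+

lemma edge_chain_arev: "edge_chain arev (arev e) = - edge_chain arev e"
  by (simp add: edge_chain_def)

lemma lookup_edge_chain:
  "e \<in> arcs G \<Longrightarrow> Poly_Mapping.lookup (edge_chain arev e) d =
     (if d = e then 1 else if d = arev e then - 1 else 0)"
  using arev_neq[of e] by (auto simp: edge_chain_def lookup_minus lookup_single when_def)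

lemma keys_edge_chain: "e \<in> arcs G \<Longrightarrow> Poly_Mapping.keys (edge_chain arev e) = {e, arev e}"
  by (auto simp: in_keys_iff lookup_edge_chain split: if_splits)

lemma chain_inner_edge_chain:
  assumes "c \<in> C1 G arev" "e \<in> arcs G"
  shows "chain_inner (edge_chain arev e) c = Poly_Mapping.lookup c e"
  using assms arev_neq[OF assms(2)]
  by (simp add: chain_inner_def keys_edge_chain lookup_edge_chain C1_def)

lemma edge_chains_orthonormal:
  assumes "e \<in> arcs G" "d \<in> arcs G"
  shows "chain_inner (edge_chain arev e) (edge_chain arev d) =
           (if e = d then 1 else if e = arev d then - 1 else 0)"
  using assms by (simp add: chain_inner_edge_chain edge_chain_C1 lookup_edge_chain)

lemma boundary_edge_chain:
  assumes "e \<in> arcs G"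
  shows "boundary G (edge_chain arev e) =
           Poly_Mapping.single (head G e) 1 - Poly_Mapping.single (tail G e) 1"
  using assms arev_neq[OF assms]
  by (simp add: boundary_def keys_edge_chain lookup_edge_chain algebra_simps
           flip: scaleR_add_left)

end

lemma lookup_scaleR_real:
  "Poly_Mapping.lookup (r *\<^sub>R c) e = r * Poly_Mapping.lookup c e" for c :: "'e \<Rightarrow>\<^sub>0 real"
proof -
  have "{i. r * Poly_Mapping.lookup c i \<noteq> 0} \<subseteq> Poly_Mapping.keys c"
    by (auto simp: in_keys_iff)
  then have "finite {i. r * Poly_Mapping.lookup c i \<noteq> 0}"
    by (rule finite_subset) simp
  then show ?thesis
    by (simp add: scaleR_poly_mapping_def)
qed

lemma lookup_sum: "Poly_Mapping.lookup (sum f A) e = (\<Sum>x\<in>A. Poly_Mapping.lookup (f x) e)"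
  by (induction A rule: infinite_finite_induct) (auto simp: lookup_add)

lemma (in bidirected_digraph) chain_eq_sum_edge_chains:
  assumes "c \<in> C1 G arev"
  shows "c = (\<Sum>e\<in>Poly_Mapping.keys c. (Poly_Mapping.lookup c e / 2) *\<^sub>R edge_chain arev e)"
proof (rule poly_mapping_eqI)
  fix d
  let ?K = "Poly_Mapping.keys c" and ?l = "Poly_Mapping.lookup c"
  have K: "?K \<subseteq> arcs G" and anti: "\<And>e. e \<in> arcs G \<Longrightarrow> ?l (arev e) = - ?l e"
    using assms by (auto simp: C1_def)
  have "Poly_Mapping.lookup (\<Sum>e\<in>?K. (?l e / 2) *\<^sub>R edge_chain arev e) d
      = (\<Sum>e\<in>?K. ?l e / 2 * (if e = d then 1 else if e = arev d then - 1 else 0))"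
    unfolding lookup_sum
  proof (rule sum.cong[OF refl])
    fix e assume "e \<in> ?K"
    then have "e \<in> arcs G" using K by auto
    then show "Poly_Mapping.lookup ((?l e / 2) *\<^sub>R edge_chain arev e) d
        = ?l e / 2 * (if e = d then 1 else if e = arev d then - 1 else 0)"
      by (auto simp: lookup_scaleR_real lookup_edge_chain)
  qed
  also have "\<dots> = ?l d"
  proof (cases "d \<in> ?K")
    case True
    then have d: "d \<in> arcs G" using K by auto
    then have ad: "arev d \<in> ?K" "arev d \<noteq> d"
      using True anti[of d] arev_neq[of d] by (auto simp: in_keys_iff)
    have "(\<Sum>e\<in>?K. ?l e / 2 * (if e = d then 1 else if e = arev d then - 1 else 0))
        = (\<Sum>e\<in>{d, arev d}. ?l e / 2 * (if e = d then 1 else if e = arev d then - 1 else 0))"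
      by (rule sum.mono_neutral_right) (use True ad in auto)
    also have "\<dots> = ?l d" using ad d anti by simp
    finally show ?thesis .
  next
    case False
    have "arev d \<notin> ?K"
    proof
      assume "arev d \<in> ?K"
      then have "arev d \<in> arcs G" "?l (arev d) \<noteq> 0" using K by (auto simp: in_keys_iff)
      then have "d \<in> ?K" using anti[of "arev d"] by (auto simp: in_keys_iff)
      with False show False by simp
    qed
    with False have "(\<Sum>e\<in>?K. ?l e / 2 * (if e = d then 1 else if e = arev d then - 1 else 0)) = 0"
      by (intro sum.neutral) auto
    then show ?thesis using False by (simp add: in_keys_iff)
  qed
  finally show "?l d
      = Poly_Mapping.lookup (\<Sum>e\<in>?K. (?l e / 2) *\<^sub>R edge_chain arev e) d" by simp
qed


subsection \<open>The orthogonal projection\<close>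

lemma chain_inner_superset:
  assumes "finite S" "Poly_Mapping.keys c \<subseteq> S"
  shows "chain_inner c d = (\<Sum>e\<in>S. Poly_Mapping.lookup c e * Poly_Mapping.lookup d e) / 2"
  unfolding chain_inner_def using assms
  by (auto intro!: sum.mono_neutral_left simp: in_keys_iff)

lemma chain_inner_commute: "chain_inner c d = chain_inner d c"
  using chain_inner_superset[of "Poly_Mapping.keys c \<union> Poly_Mapping.keys d" c d]
    chain_inner_superset[of "Poly_Mapping.keys c \<union> Poly_Mapping.keys d" d c]
  by (simp add: mult.commute)

lemma linear_chain_inner: "linear (\<lambda>d. chain_inner c d)"
  by (rule linearI)
    (simp_all add: chain_inner_def lookup_add lookup_scaleR_real sum.distrib algebra_simps
      add_divide_distrib sum_distrib_left)

lemmas chain_inner_right =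
  linear_add[OF linear_chain_inner] linear_diff[OF linear_chain_inner]
  linear_scale[OF linear_chain_inner] linear_0[OF linear_chain_inner]

lemma chain_inner_left:
  "chain_inner (c + c') d = chain_inner c d + chain_inner c' d"
  "chain_inner (c - c') d = chain_inner c d - chain_inner c' d"
  "chain_inner (r *\<^sub>R c) d = r * chain_inner c d"
  "chain_inner 0 d = 0"
  using chain_inner_right by (simp_all add: chain_inner_commute[of _ d])

lemma chain_inner_eq_0: "chain_inner c c = 0 \<Longrightarrow> c = 0"
  by (rule poly_mapping_eqI)
    (auto simp: chain_inner_def sum_nonneg_eq_0_iff in_keys_iff)

lemma subspace_C1: "subspace (C1 G rv)" for G :: "('a, 'b) pre_digraph"
proof (rule subspaceI)
  fix c d :: "'b \<Rightarrow>\<^sub>0 real" assume "c \<in> C1 G rv" "d \<in> C1 G rv"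
  then show "c + d \<in> C1 G rv"
    using keys_add[of c d] by (auto simp: C1_def lookup_add)
next
  fix r and c :: "'b \<Rightarrow>\<^sub>0 real" assume "c \<in> C1 G rv"
  then show "r *\<^sub>R c \<in> C1 G rv"
    by (auto simp: C1_def lookup_scaleR_real in_keys_iff)
qed (simp add: C1_def)

lemma boundary_superset:
  assumes "finite S" "Poly_Mapping.keys c \<subseteq> S"
  shows "boundary G c = (\<Sum>e\<in>S. (Poly_Mapping.lookup c e / 2) *\<^sub>R
     (Poly_Mapping.single (head G e) 1 - Poly_Mapping.single (tail G e) 1))"
  unfolding boundary_def using assms
  by (auto intro!: sum.mono_neutral_left simp: in_keys_iff)

lemma linear_boundary: "linear (boundary G)" for G :: "('a, 'b) pre_digraph"
proof (rule linearI)
  fix c d :: "'b \<Rightarrow>\<^sub>0 real"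
  let ?S = "Poly_Mapping.keys c \<union> Poly_Mapping.keys d"
  show "boundary G (c + d) = boundary G c + boundary G d"
    using boundary_superset[of ?S c G] boundary_superset[of ?S d G]
      boundary_superset[of ?S "c + d" G] keys_add[of c d]
    by (simp add: lookup_add add_divide_distrib scaleR_add_left sum.distrib)
next
  fix r and c :: "'b \<Rightarrow>\<^sub>0 real"
  have "Poly_Mapping.keys (r *\<^sub>R c) \<subseteq> Poly_Mapping.keys c"
    by (auto simp: in_keys_iff lookup_scaleR_real)
  then show "boundary G (r *\<^sub>R c) = r *\<^sub>R boundary G c"
    using boundary_superset[of "Poly_Mapping.keys c" "r *\<^sub>R c" G]
      boundary_superset[of "Poly_Mapping.keys c" c G]
    by (simp add: lookup_scaleR_real scaleR_sum_right)
qed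

lemma subspace_Z1: "subspace (Z1 G rv)"
  unfolding Z1_def using subspace_C1[of G rv]
  by (auto simp: subspace_def linear_0[OF linear_boundary] linear_add[OF linear_boundary]
      linear_scale[OF linear_boundary])

lemma is_cycle_proj_unique:
  assumes "is_cycle_proj G rv c z" "is_cycle_proj G rv c z'"
  shows "z = z'"
proof -
  have "z - z' \<in> Z1 G rv"
    using assms subspace_diff[OF subspace_Z1] by (auto simp: is_cycle_proj_def)
  then have "chain_inner (c - z) (z - z') = 0" "chain_inner (c - z') (z - z') = 0"
    using assms by (auto simp: is_cycle_proj_def)
  then have "chain_inner (z - z') (z - z') = 0"
    by (simp add: chain_inner_left)
  from chain_inner_eq_0[OF this] show ?thesis by simp
qed

lemma cycle_proj_eq: "is_cycle_proj G rv c z \<Longrightarrow> cycle_proj G rv c = z"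
  unfolding cycle_proj_def using is_cycle_proj_unique by blast

lemma orthogonal_proj_span:
  assumes "finite B"
  shows "\<exists>z\<in>span B. \<forall>w\<in>span B. chain_inner (c - z) w = 0"
  using assms
proof (induction B arbitrary: c)
  case empty
  show ?case by (simp add: chain_inner_right)
next
  case (insert b B)
  obtain y where y: "y \<in> span B" "\<And>w. w \<in> span B \<Longrightarrow> chain_inner (b - y) w = 0"
    using insert.IH[of b] by blast
  obtain z where z: "z \<in> span B" "\<And>w. w \<in> span B \<Longrightarrow> chain_inner (c - z) w = 0"
    using insert.IH[of c] by blast
  define k where "k = chain_inner c (b - y) / chain_inner (b - y) (b - y)"
  define z' where "z' = z + k *\<^sub>R (b - y)"
  have sub: "span B \<subseteq> span (insert b B)" by (rule span_mono) auto
  have "b \<in> span (insert b B)" by (simp add: span_base)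
  then have "z' \<in> span (insert b B)"
    unfolding z'_def using y(1) z(1) sub by (auto intro!: span_add span_scale span_diff)
  moreover have "chain_inner (c - z') w = 0" if w: "w \<in> span (insert b B)" for w
  proof -
    obtain a where a: "w - a *\<^sub>R b \<in> span B" using w unfolding span_insert by blast
    have u: "w - a *\<^sub>R (b - y) \<in> span B"
      using span_add[OF a span_scale[OF y(1), of a]] by (simp add: algebra_simps)
    let ?u = "w - a *\<^sub>R (b - y)"
    have k: "k * chain_inner (b - y) (b - y) = chain_inner c (b - y)"
      using chain_inner_eq_0[of "b - y"] by (auto simp: k_def chain_inner_right)
    have "chain_inner (c - z') ?u = 0"
      using y(2)[OF u] z(2)[OF u] by (simp add: z'_def chain_inner_left)
    moreover have "chain_inner z (b - y) = 0"
      using y(2)[OF z(1)] chain_inner_commute by metis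
    then have "chain_inner (c - z') (b - y) = 0"
      using k unfolding z'_def chain_inner_left by simp
    moreover have "chain_inner (c - z') w
        = chain_inner (c - z') ?u + a * chain_inner (c - z') (b - y)"
      using chain_inner_right(2)[of "c - z'" w "a *\<^sub>R (b - y)"]
        chain_inner_right(3)[of "c - z'" a "b - y"] by simp
    ultimately show ?thesis by simp
  qed
  ultimately show ?case by blast
qed

lemma has_cycle_proj_finite:
  assumes "finite (arcs G)"
  shows "has_cycle_proj G rv"
proof -
  let ?E = "(\<lambda>e. Poly_Mapping.single e (1::real)) ` arcs G"
  have E: "Z1 G rv \<subseteq> span ?E"
  proof
    fix c assume "c \<in> Z1 G rv"
    then have K: "Poly_Mapping.keys c \<subseteq> arcs G" by (auto simp: Z1_def C1_def)
    have "c = (\<Sum>e\<in>Poly_Mapping.keys c. Poly_Mapping.lookup c e *\<^sub>R Poly_Mapping.single e 1)"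
      by (rule poly_mapping_eqI)
        (auto simp: lookup_sum lookup_scaleR_real lookup_single when_def in_keys_iff
          if_distrib sum.delta cong: if_cong)
    also have "\<dots> \<in> span ?E"
      using K by (intro span_sum span_scale span_base) auto
    finally show "c \<in> span ?E" .
  qed
  obtain B where B: "B \<subseteq> Z1 G rv" "independent B" "Z1 G rv \<subseteq> span B"
    using maximal_independent_subset by blast
  have "finite B"
    using independent_span_bound[OF _ B(2), of ?E] assms B(1) E by auto
  moreover have "span B = Z1 G rv"
    using B by (metis span_subspace subspace_Z1)
  ultimately show ?thesis
    using orthogonal_proj_span[of B] unfolding has_cycle_proj_def is_cycle_proj_def by metis
qed

end

theory Submission
  imports Defs
begin

text \<open>
  Uniqueness. A loop \<open>\<gamma>\<close> at the basepoint has a chain \<open>c\<^sub>\<gamma>\<close> that is already a cycle, so the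
  projection fixes it and \<open>c\<^sub>\<gamma>\<close> is the position of the atom of \<open>\<gamma>\<close>. In a connected graph these
  chains span the space of cycles (lemma \<open>Z1_subset_span_loops\<close>), and the trivial loop has
  position \<open>0\<close>. An affine map is determined by its values on a spanning set that contains \<open>0\<close>, so
  an equivariant affine action is determined by what the group does to the atoms.

  Existence. Let \<open>g\<close> be an automorphism of the cover lying over an automorphism \<open>f\<close> of the graph,
  and let \<open>\<beta>\<close> be a path whose class is the image of the trivial class under \<open>g\<close>. A map of the cover
  is determined by lifting edges one at a time, so \<open>g\<close> sends the class of \<open>\<alpha>\<close> to the class of
  \<open>\<beta>\<close> followed by \<open>f(\<alpha>)\<close> (lemma \<open>Cov_acts_on_class\<close>). The chain of that path is
  \<open>c\<^sub>\<beta> + f\<^sub>* c\<^sub>\<alpha>\<close>. The linear map \<open>f\<^sub>*\<close> permutes the edges, hence preserves inner products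
  and maps the cycles onto the cycles; therefore it commutes with the orthogonal projection
  (lemma \<open>is_cycle_proj_push\<close>). Thus \<open>z \<mapsto> f\<^sub>* z + \<pi>(c\<^sub>\<beta>)\<close> is an isometric affine map inducing
  the action of \<open>g\<close> on positions of atoms (lemma \<open>Cov_affine\<close>).

  The automorphism \<open>f\<close> and the path \<open>\<beta>\<close> are choices, so neither multiplicativity nor
  invertibility of the resulting maps is read off from the formula. Both follow from
  uniqueness instead: two affine maps inducing the same map on positions of atoms are equal
  (lemma \<open>unique_affine_action\<close>).
\<close>

section \<open>Affine actions determined by a spanning orbit\<close>

text \<open>
  Bijectivity, which is part of \<^const>\<open>affine_transformation\<close>, is left out: for the maps built
  below it is a consequence of the group law.
\<close>

definition affine_on :: "'a::real_vector set \<Rightarrow> ('a \<Rightarrow> 'a) \<Rightarrow> bool" where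
  "affine_on S T \<longleftrightarrow> (\<exists>L. linear_map_on S L \<and> (\<exists>b\<in>S. \<forall>x\<in>S. T x = L x + b))"

lemma affine_on_cong: "affine_on S T \<Longrightarrow> (\<And>x. x \<in> S \<Longrightarrow> T' x = T x) \<Longrightarrow> affine_on S T'"
  unfolding affine_on_def by metis

lemma affine_on_funcset: "affine_on S T \<Longrightarrow> subspace S \<Longrightarrow> x \<in> S \<Longrightarrow> T x \<in> S"
  unfolding affine_on_def by (auto simp: linear_map_on_def Pi_iff subspace_add)

lemma affine_on_id: "subspace S \<Longrightarrow> affine_on S (\<lambda>x. x)"
  unfolding affine_on_def
  by (rule exI[of _ "\<lambda>x. x"]) (auto simp: linear_map_on_def subspace_0 intro!: bexI[of _ 0])

lemma affine_on_compose:
  assumes "subspace S" "affine_on S T" "affine_on S T'"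
  shows "affine_on S (\<lambda>x. T (T' x))"
proof -
  obtain L b where L: "linear_map_on S L" "b \<in> S" "\<And>x. x \<in> S \<Longrightarrow> T x = L x + b"
    using assms(2) unfolding affine_on_def by blast
  obtain L' b' where L': "linear_map_on S L'" "b' \<in> S" "\<And>x. x \<in> S \<Longrightarrow> T' x = L' x + b'"
    using assms(3) unfolding affine_on_def by blast
  have "linear_map_on S (\<lambda>x. L (L' x))"
    using L(1) L'(1) by (auto simp: linear_map_on_def Pi_iff)
  moreover have "L b' + b \<in> S"
    using L(1,2) L'(2) by (auto simp: linear_map_on_def Pi_iff intro!: subspace_add assms(1))
  moreover have "T (T' x) = L (L' x) + (L b' + b)" if "x \<in> S" for x
  proof -
    have "L' x \<in> S" using L'(1) that by (auto simp: linear_map_on_def)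
    then show ?thesis
      using that L L' assms(1) by (simp add: linear_map_on_def subspace_add add.assoc)
  qed
  ultimately show ?thesis unfolding affine_on_def by blast
qed

text \<open>
  Since \<open>0 \<in> B\<close>, the translation parts agree; then the linear parts agree on \<open>B\<close>, hence on the
  subspace that \<open>B\<close> spans. The point \<open>0\<close> makes the affine hull of \<open>B\<close> equal to its span.
\<close>

lemma affine_on_eqI:
  assumes "subspace S" "affine_on S T" "affine_on S T'"
    and "B \<subseteq> S" "0 \<in> B" "S \<subseteq> span B"
    and agree: "\<And>x. x \<in> B \<Longrightarrow> T x = T' x"
    and "x \<in> S"
  shows "T x = T' x"
proof -
  obtain L b where L: "linear_map_on S L" "b \<in> S" "\<And>x. x \<in> S \<Longrightarrow> T x = L x + b"
    using assms(2) unfolding affine_on_def by blast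
  obtain L' b' where L': "linear_map_on S L'" "b' \<in> S" "\<And>x. x \<in> S \<Longrightarrow> T' x = L' x + b'"
    using assms(3) unfolding affine_on_def by blast
  have 0: "0 \<in> S" using assms(1) by (rule subspace_0)
  have "L (0 *\<^sub>R 0) = 0 *\<^sub>R L 0" "L' (0 *\<^sub>R 0) = 0 *\<^sub>R L' 0"
    using L(1) L'(1) 0 unfolding linear_map_on_def by blast+
  then have L0: "L 0 = 0" "L' 0 = 0" by simp_all
  have "b = b'" using agree[OF assms(5)] L(3)[OF 0] L'(3)[OF 0] L0 by simp
  have "subspace {x \<in> S. L x = L' x}"
    using L(1) L'(1) assms(1) L0 by (auto simp: linear_map_on_def subspace_def)
  moreover have "B \<subseteq> {x \<in> S. L x = L' x}"
  proof
    fix x assume x: "x \<in> B"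
    then have "x \<in> S" using assms(4) by blast
    then show "x \<in> {x \<in> S. L x = L' x}"
      using agree[OF x] L(3)[of x] L'(3)[of x] \<open>b = b'\<close> by simp
  qed
  ultimately have "span B \<subseteq> {x \<in> S. L x = L' x}" by (rule span_minimal[rotated])
  then show ?thesis using assms(6,8) L(3) L'(3) \<open>b = b'\<close> by auto
qed

text \<open>
  If every group element moves the points \<open>i a\<close> as some affine map does, these affine maps form
  an action. The maps for \<open>g h\<close> and for \<open>g\<close> after \<open>h\<close> agree on the spanning points \<open>i a\<close>, hence
  everywhere; likewise the map for the unit is the identity, which makes the map for the inverse
  of \<open>g\<close> an inverse of the map for \<open>g\<close>.
\<close>

lemma unique_affine_action:
  fixes \<Gamma> :: "('g, 'm) monoid_scheme" (structure) and S :: "'a::real_vector set"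
    and i :: "'p \<Rightarrow> 'a" and act :: "'g \<Rightarrow> 'p \<Rightarrow> 'p"
  assumes "group \<Gamma>" "subspace S"
    and act: "\<And>g a. g \<in> carrier \<Gamma> \<Longrightarrow> a \<in> A \<Longrightarrow> act g a \<in> A"
      "\<And>a. a \<in> A \<Longrightarrow> act \<one> a = a"
      "\<And>g h a. g \<in> carrier \<Gamma> \<Longrightarrow> h \<in> carrier \<Gamma> \<Longrightarrow> a \<in> A \<Longrightarrow> act (g \<otimes> h) a = act g (act h a)"
    and i: "i ` A \<subseteq> S" "0 \<in> i ` A" "S \<subseteq> span (i ` A)"
    and ex: "\<And>g. g \<in> carrier \<Gamma> \<Longrightarrow> \<exists>T. affine_on S T \<and> (\<forall>a\<in>A. T (i a) = i (act g a))"
  shows "\<exists>!\<rho>. affine_action \<Gamma> S \<rho> \<and> (\<forall>g\<in>carrier \<Gamma>. \<forall>a\<in>A. \<rho> g (i a) = i (act g a))"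
proof -
  interpret group \<Gamma> by fact
  have iS: "i a \<in> S" if "a \<in> A" for a using i(1) that by blast
  obtain T where T: "\<And>g. g \<in> carrier \<Gamma> \<Longrightarrow> affine_on S (T g)"
      "\<And>g a. g \<in> carrier \<Gamma> \<Longrightarrow> a \<in> A \<Longrightarrow> T g (i a) = i (act g a)"
    using ex by metis
  have TS: "T g x \<in> S" if "g \<in> carrier \<Gamma>" "x \<in> S" for g x
    using affine_on_funcset[OF T(1)] that assms(2) by blast
  have uniq: "U x = U' x"
    if "affine_on S U" "affine_on S U'" "\<And>a. a \<in> A \<Longrightarrow> U (i a) = U' (i a)" "x \<in> S" for U U' x
    by (rule affine_on_eqI[OF assms(2) that(1,2) i]) (use that(3,4) in auto)
  have T1: "T \<one> x = x" if "x \<in> S" for x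
    by (rule uniq[OF T(1) affine_on_id _ that]) (use T(2) act assms(2) in auto)
  have Tmult: "T (g \<otimes> h) x = T g (T h x)"
    if "g \<in> carrier \<Gamma>" "h \<in> carrier \<Gamma>" "x \<in> S" for g h x
    by (rule uniq[OF T(1) affine_on_compose[OF assms(2) T(1) T(1)] _ that(3)])
      (use that T(2) act in auto)
  define \<rho> where "\<rho> = (\<lambda>g\<in>carrier \<Gamma>. restrict (T g) S)"
  have Bij: "\<rho> g \<in> Bij S" if g: "g \<in> carrier \<Gamma>" for g
  proof -
    have "bij_betw (T g) S S"
    proof (rule bij_betw_byWitness[of _ "T (inv g)"])
      show "\<forall>x\<in>S. T (inv g) (T g x) = x" "\<forall>x\<in>S. T g (T (inv g) x) = x"
        using g Tmult[of "inv g" g] Tmult[of g "inv g"] T1 by auto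
    qed (use g TS in auto)
    then show ?thesis using g by (auto simp: \<rho>_def Bij_def cong: bij_betw_cong)
  qed
  have "group_action \<Gamma> S \<rho>"
  proof (intro group_action.intro group_hom.intro group_hom_axioms.intro homI)
    show "\<rho> (g \<otimes> h) = \<rho> g \<otimes>\<^bsub>BijGroup S\<^esub> \<rho> h" if "g \<in> carrier \<Gamma>" "h \<in> carrier \<Gamma>" for g h
      using that Bij TS Tmult
      by (auto simp: BijGroup_def \<rho>_def compose_def restrict_def fun_eq_iff)
  qed (use assms(1) group_BijGroup Bij in \<open>auto simp: BijGroup_def\<close>)
  moreover have "affine_on S (\<rho> g)" if "g \<in> carrier \<Gamma>" for g
    by (rule affine_on_cong[OF T(1)]) (use that in \<open>auto simp: \<rho>_def\<close>)
  ultimately have "affine_action \<Gamma> S \<rho>"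
    using Bij unfolding affine_action_def affine_transformation_def affine_on_def
    by (auto simp: \<rho>_def)
  moreover have "\<forall>g\<in>carrier \<Gamma>. \<forall>a\<in>A. \<rho> g (i a) = i (act g a)"
    using T(2) iS by (auto simp: \<rho>_def)
  moreover have "\<sigma> = \<rho>"
    if s: "affine_action \<Gamma> S \<sigma>" "\<forall>g\<in>carrier \<Gamma>. \<forall>a\<in>A. \<sigma> g (i a) = i (act g a)" for \<sigma>
  proof (rule extensionalityI[of _ "carrier \<Gamma>"])
    fix g assume g: "g \<in> carrier \<Gamma>"
    have sg: "\<sigma> g \<in> Bij S" "affine_on S (\<sigma> g)"
      using s(1) g unfolding affine_action_def affine_transformation_def affine_on_def by auto
    show "\<sigma> g = \<rho> g"
    proof (rule extensionalityI[of _ S])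
      fix x assume x: "x \<in> S"
      have "\<sigma> g x = T g x"
        by (rule uniq[OF sg(2) T(1)[OF g] _ x]) (use s(2) T(2) g in auto)
      then show "\<sigma> g x = \<rho> g x" using g x by (simp add: \<rho>_def)
    qed (use sg Bij g Bij_imp_extensional in auto)
  qed (use s(1) in \<open>auto simp: affine_action_def \<rho>_def\<close>)
  ultimately show ?thesis by blast
qed


section \<open>Linear extension of a function on generators\<close>

text \<open>
  The finitely supported functions are the free vector space on their index type; this is the
  linear map out of it given by its values on the basis. The boundary and the maps induced by
  functions on edges or vertices are all of this form, so that identities between them reduce to
  identities on basis elements.
\<close>

definition lin_ext :: "('a \<Rightarrow> 'b::real_vector) \<Rightarrow> ('a \<Rightarrow>\<^sub>0 real) \<Rightarrow> 'b" where
  "lin_ext \<kappa> c = (\<Sum>e\<in>Poly_Mapping.keys c. Poly_Mapping.lookup c e *\<^sub>R \<kappa> e)"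

lemma lin_ext_superset:
  assumes "finite A" "Poly_Mapping.keys c \<subseteq> A"
  shows "lin_ext \<kappa> c = (\<Sum>e\<in>A. Poly_Mapping.lookup c e *\<^sub>R \<kappa> e)"
  unfolding lin_ext_def using assms by (auto intro!: sum.mono_neutral_left simp: in_keys_iff)

lemma linear_lin_ext: "linear (lin_ext \<kappa>)"
proof (rule linearI)
  fix c d :: "'a \<Rightarrow>\<^sub>0 real"
  let ?A = "Poly_Mapping.keys c \<union> Poly_Mapping.keys d"
  show "lin_ext \<kappa> (c + d) = lin_ext \<kappa> c + lin_ext \<kappa> d"
    using lin_ext_superset[of ?A _ \<kappa>] keys_add[of c d]
    by (simp add: lookup_add scaleR_add_left sum.distrib)
next
  fix r and c :: "'a \<Rightarrow>\<^sub>0 real"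
  have "Poly_Mapping.keys (r *\<^sub>R c) \<subseteq> Poly_Mapping.keys c"
    by (auto simp: in_keys_iff lookup_scaleR_real)
  then show "lin_ext \<kappa> (r *\<^sub>R c) = r *\<^sub>R lin_ext \<kappa> c"
    using lin_ext_superset[of "Poly_Mapping.keys c" _ \<kappa>]
    by (simp add: lookup_scaleR_real scaleR_sum_right)
qed

lemmas lin_ext_linear =
  linear_add[OF linear_lin_ext] linear_diff[OF linear_lin_ext]
  linear_scale[OF linear_lin_ext] linear_0[OF linear_lin_ext]

lemma lin_ext_single [simp]: "lin_ext \<kappa> (Poly_Mapping.single e 1) = \<kappa> e"
  by (simp add: lin_ext_def)

lemma linear_lin_ext_comp: "linear h \<Longrightarrow> h (lin_ext \<kappa> c) = lin_ext (\<lambda>e. h (\<kappa> e)) c"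
  by (simp add: lin_ext_def linear_sum linear_scale)

lemma lin_ext_cong:
  "(\<And>e. e \<in> Poly_Mapping.keys c \<Longrightarrow> \<kappa> e = \<mu> e) \<Longrightarrow> lin_ext \<kappa> c = lin_ext \<mu> c"
  by (simp add: lin_ext_def)

lemma lin_ext_ident: "lin_ext (\<lambda>e. Poly_Mapping.single e 1) c = c"
  by (rule poly_mapping_eqI)
    (auto simp: lin_ext_def lookup_sum lookup_scaleR_real lookup_single when_def in_keys_iff
      if_distrib sum.delta cong: if_cong)

text \<open>
  The factor \<open>1/2\<close> compensates for a chain listing every undirected edge twice, once in each
  direction.
\<close>

lemma boundary_eq_lin_ext:
  "boundary G = lin_ext (\<lambda>e. (1/2) *\<^sub>R
     (Poly_Mapping.single (head G e) 1 - Poly_Mapping.single (tail G e) 1))"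
  by (rule ext) (simp add: boundary_def lin_ext_def)

text \<open>
  The induced map \<open>f\<^sub>*\<close> on chains.
\<close>

definition push :: "('a \<Rightarrow> 'b) \<Rightarrow> ('a \<Rightarrow>\<^sub>0 real) \<Rightarrow> ('b \<Rightarrow>\<^sub>0 real)" where
  "push f = lin_ext (\<lambda>e. Poly_Mapping.single (f e) 1)"

lemma linear_push: "linear (push f)"
  unfolding push_def by (rule linear_lin_ext)

lemma push_single [simp]: "push f (Poly_Mapping.single e 1) = Poly_Mapping.single (f e) 1"
  by (simp add: push_def)

lemma push_push_cancel:
  assumes "\<And>e. e \<in> Poly_Mapping.keys c \<Longrightarrow> f (g e) = e"
  shows "push f (push g c) = c"
proof -
  have "push f (push g c) = lin_ext (\<lambda>e. Poly_Mapping.single (f (g e)) 1) c"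
    unfolding push_def[of g] by (simp add: linear_lin_ext_comp[OF linear_push])
  also have "\<dots> = lin_ext (\<lambda>e. Poly_Mapping.single e 1) c"
    using assms by (intro lin_ext_cong) simp
  also have "\<dots> = c" by (rule lin_ext_ident)
  finally show ?thesis .
qed

lemma lookup_push:
  "Poly_Mapping.lookup (push f c) d
     = (\<Sum>e\<in>Poly_Mapping.keys c. if f e = d then Poly_Mapping.lookup c e else 0)"
  by (auto simp: push_def lin_ext_def lookup_sum lookup_scaleR_real lookup_single when_def
      intro!: sum.cong)

lemma lookup_push_inj:
  assumes "inj_on f A" "Poly_Mapping.keys c \<subseteq> A" "e \<in> A"
  shows "Poly_Mapping.lookup (push f c) (f e) = Poly_Mapping.lookup c e"
proof -
  have "Poly_Mapping.lookup (push f c) (f e)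
      = (\<Sum>d\<in>Poly_Mapping.keys c. if d = e then Poly_Mapping.lookup c d else 0)"
    unfolding lookup_push using assms by (intro sum.cong) (auto dest: inj_onD)
  then show ?thesis by (simp add: in_keys_iff)
qed

lemma keys_push: "Poly_Mapping.keys (push f c) \<subseteq> f ` Poly_Mapping.keys c"
proof
  fix d assume d: "d \<in> Poly_Mapping.keys (push f c)"
  show "d \<in> f ` Poly_Mapping.keys c"
  proof (rule ccontr)
    assume "d \<notin> f ` Poly_Mapping.keys c"
    then have "Poly_Mapping.lookup (push f c) d = 0"
      unfolding lookup_push by (intro sum.neutral) auto
    with d show False by (simp add: in_keys_iff)
  qed
qed

lemma chain_inner_push:
  assumes "inj_on f A" "Poly_Mapping.keys c \<subseteq> A" "Poly_Mapping.keys d \<subseteq> A"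
  shows "chain_inner (push f c) (push f d) = chain_inner c d"
proof -
  have inj: "inj_on f (Poly_Mapping.keys c)" using assms inj_on_subset by blast
  have "chain_inner (push f c) (push f d)
      = (\<Sum>e\<in>f ` Poly_Mapping.keys c.
          Poly_Mapping.lookup (push f c) e * Poly_Mapping.lookup (push f d) e) / 2"
    by (intro chain_inner_superset keys_push) simp
  also have "\<dots> = (\<Sum>e\<in>Poly_Mapping.keys c. Poly_Mapping.lookup c e * Poly_Mapping.lookup d e) / 2"
    unfolding sum.reindex[OF inj]
    using assms by (auto intro!: sum.cong simp: lookup_push_inj[OF assms(1)] subset_iff)
  finally show ?thesis by (simp add: chain_inner_def)
qed


section \<open>Groups of automorphisms\<close>

lemma BijGroup_prod_group: "group (BijGroup S \<times>\<times> BijGroup S')"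
  by (intro DirProd_group group_BijGroup)

lemma Bij_mem: "f \<in> Bij S \<Longrightarrow> x \<in> S \<Longrightarrow> f x \<in> S"
  using Bij_imp_funcset by blast

lemma Bij_inverse:
  assumes "f \<in> Bij S"
  shows "inv\<^bsub>BijGroup S\<^esub> f \<in> Bij S"
    and "x \<in> S \<Longrightarrow> (inv\<^bsub>BijGroup S\<^esub> f) (f x) = x"
    and "x \<in> S \<Longrightarrow> f ((inv\<^bsub>BijGroup S\<^esub> f) x) = x"
proof -
  have f: "inj_on f S" "f ` S = S" using assms by (auto simp: Bij_def bij_betw_def)
  show "inv\<^bsub>BijGroup S\<^esub> f \<in> Bij S"
    unfolding inv_BijGroup[OF assms] by (rule restrict_inv_into_Bij[OF assms])
  show "x \<in> S \<Longrightarrow> (inv\<^bsub>BijGroup S\<^esub> f) (f x) = x"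
    using f Bij_mem[OF assms] by (simp add: inv_BijGroup[OF assms])
  show "x \<in> S \<Longrightarrow> f ((inv\<^bsub>BijGroup S\<^esub> f) x) = x"
    using f by (simp add: inv_BijGroup[OF assms] f_inv_into_f)
qed

lemma automorphisms_iff:
  "(\<phi>, \<psi>) \<in> automorphisms G rv \<longleftrightarrow> \<phi> \<in> Bij (verts G) \<and> \<psi> \<in> Bij (arcs G) \<and>
     (\<forall>e\<in>arcs G. tail G (\<psi> e) = \<phi> (tail G e) \<and> head G (\<psi> e) = \<phi> (head G e) \<and>
        \<psi> (rv e) = rv (\<psi> e))"
  by (auto simp: automorphisms_def graph_map_def Pi_iff Bij_mem)

text \<open>
  The inverse preserves tails, heads and reversals because every edge \<open>e\<close> is the image of its
  preimage, for which the original automorphism preserves them.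
\<close>

lemma (in bidirected_digraph) automorphism_inverse:
  assumes "(\<phi>, \<psi>) \<in> automorphisms G arev"
  shows "(inv\<^bsub>BijGroup (verts G)\<^esub> \<phi>, inv\<^bsub>BijGroup (arcs G)\<^esub> \<psi>) \<in> automorphisms G arev"
proof -
  let ?\<phi> = "inv\<^bsub>BijGroup (verts G)\<^esub> \<phi>" and ?\<psi> = "inv\<^bsub>BijGroup (arcs G)\<^esub> \<psi>"
  have \<phi>: "\<phi> \<in> Bij (verts G)" and \<psi>: "\<psi> \<in> Bij (arcs G)"
    using assms by (simp_all add: automorphisms_iff)
  have "tail G (?\<psi> e) = ?\<phi> (tail G e) \<and> head G (?\<psi> e) = ?\<phi> (head G e) \<and>
      ?\<psi> (arev e) = arev (?\<psi> e)" if e: "e \<in> arcs G" for e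
  proof -
    have d: "?\<psi> e \<in> arcs G" "\<psi> (?\<psi> e) = e"
      using Bij_inverse[OF \<psi>] e Bij_mem by auto
    then have *: "tail G e = \<phi> (tail G (?\<psi> e))" "head G e = \<phi> (head G (?\<psi> e))"
      "arev e = \<psi> (arev (?\<psi> e))"
      using assms unfolding automorphisms_iff by metis+
    show ?thesis
      unfolding * using d Bij_inverse(2)[OF \<phi>] Bij_inverse(2)[OF \<psi>] by simp
  qed
  then show ?thesis
    using Bij_inverse(1)[OF \<phi>] Bij_inverse(1)[OF \<psi>] by (simp add: automorphisms_iff)
qed

lemma (in bidirected_digraph) automorphism_compose:
  assumes "(\<phi>, \<psi>) \<in> automorphisms G arev" "(\<phi>', \<psi>') \<in> automorphisms G arev"
  shows "(compose (verts G) \<phi> \<phi>', compose (arcs G) \<psi> \<psi>') \<in> automorphisms G arev"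
  using assms by (auto simp: automorphisms_iff compose_Bij compose_eq Bij_mem)

lemma (in bidirected_digraph) automorphism_id:
  "(\<lambda>x\<in>verts G. x, \<lambda>e\<in>arcs G. e) \<in> automorphisms G arev"
  by (auto simp: automorphisms_iff id_Bij)

context bidirected_digraph
begin

lemma atomE:
  assumes "a \<in> atoms G arev x0"
  obtains p where "a = homology_class G arev x0 p" "awalk x0 p (atom_vert G x0 a)"
  using assms atom_vert_class unfolding atoms_def by blast

lemma trivial_atom: "x0 \<in> verts G \<Longrightarrow> homology_class G arev x0 [] \<in> atoms G arev x0"
  unfolding atoms_def using awalk_Nil_iff by blast

lemma atom_vert_in_verts: "a \<in> atoms G arev x0 \<Longrightarrow> atom_vert G x0 a \<in> verts G"
  by (metis atomE awalk_last_in_verts)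

text \<open>
  The equation \<open>q \<circ> g = f \<circ> q\<close> for the covering map \<open>q\<close>, on vertices and on edges.
\<close>

definition covers ::
  "'a \<Rightarrow> ('b list set \<Rightarrow> 'b list set) \<times> ('b list set \<times> 'b \<Rightarrow> 'b list set \<times> 'b)
     \<Rightarrow> ('a \<Rightarrow> 'a) \<times> ('b \<Rightarrow> 'b) \<Rightarrow> bool" where
  "covers x0 g f \<longleftrightarrow>
     (\<forall>a\<in>verts (cover G arev x0). atom_vert G x0 (fst g a) = fst f (atom_vert G x0 a)) \<and>
     (\<forall>d\<in>arcs (cover G arev x0). snd (snd g d) = snd f (snd d))"

lemma carrier_Cov_iff:
  "(\<phi>, \<psi>) \<in> carrier (Cov G arev x0) \<longleftrightarrow>
     (\<phi>, \<psi>) \<in> automorphisms (cover G arev x0) (cover_rev G arev x0) \<and>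
     (\<exists>f\<in>automorphisms G arev. covers x0 (\<phi>, \<psi>) f)"
  unfolding Cov_def covers_def by (simp add: case_prod_unfold)

text \<open>
  The relation \<^const>\<open>covers\<close> is compatible with composition and inverses, so the automorphisms of
  the cover that lie over some automorphism of the graph are a subgroup of the group of pairs of
  bijections.
\<close>

lemma group_Cov: "group (Cov G arev x0)"
proof -
  interpret C: bidirected_digraph "cover G arev x0" "cover_rev G arev x0"
    by (rule bidirected_cover)
  let ?V = "verts (cover G arev x0)" and ?E = "arcs (cover G arev x0)"
  let ?P = "BijGroup ?V \<times>\<times> BijGroup ?E" and ?H = "carrier (Cov G arev x0)"
  interpret P: group ?P by (rule BijGroup_prod_group)
  have V: "atom_vert G x0 a \<in> verts G" if "a \<in> ?V" for a
    using that atom_vert_in_verts by (simp add: cover_def)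
  have E: "snd d \<in> arcs G" if "d \<in> ?E" for d
    using that by (auto simp: cover_def)
  have "subgroup ?H ?P"
  proof (rule P.subgroupI)
    show "?H \<subseteq> carrier ?P"
      by (auto simp: carrier_Cov_iff automorphisms_iff BijGroup_def)
    have "covers x0 (\<lambda>x\<in>?V. x, \<lambda>e\<in>?E. e) (\<lambda>x\<in>verts G. x, \<lambda>e\<in>arcs G. e)"
      using V E by (simp add: covers_def)
    then show "?H \<noteq> {}"
      using C.automorphism_id automorphism_id carrier_Cov_iff by blast
  next
    fix g assume "g \<in> ?H"
    then obtain \<phi> \<psi> fv fe where g: "g = (\<phi>, \<psi>)"
      "(\<phi>, \<psi>) \<in> automorphisms (cover G arev x0) (cover_rev G arev x0)"
      "(fv, fe) \<in> automorphisms G arev" "covers x0 (\<phi>, \<psi>) (fv, fe)"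
      by (cases g) (auto simp: carrier_Cov_iff)
    have B: "\<phi> \<in> Bij ?V" "\<psi> \<in> Bij ?E" "fv \<in> Bij (verts G)" "fe \<in> Bij (arcs G)"
      using g(2,3) by (auto simp: automorphisms_iff)
    have "covers x0 (inv\<^bsub>BijGroup ?V\<^esub> \<phi>, inv\<^bsub>BijGroup ?E\<^esub> \<psi>)
        (inv\<^bsub>BijGroup (verts G)\<^esub> fv, inv\<^bsub>BijGroup (arcs G)\<^esub> fe)"
      unfolding covers_def fst_conv snd_conv
    proof (intro conjI ballI)
      fix a assume a: "a \<in> ?V"
      let ?a = "(inv\<^bsub>BijGroup ?V\<^esub> \<phi>) a"
      have a': "?a \<in> ?V" "\<phi> ?a = a" using Bij_inverse[OF B(1)] a Bij_mem by auto
      then have "atom_vert G x0 a = fv (atom_vert G x0 ?a)"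
        using g(4) unfolding covers_def by (metis fst_conv)
      then show "atom_vert G x0 ?a = (inv\<^bsub>BijGroup (verts G)\<^esub> fv) (atom_vert G x0 a)"
        using Bij_inverse(2)[OF B(3)] V a' by simp
    next
      fix d assume d: "d \<in> ?E"
      let ?d = "(inv\<^bsub>BijGroup ?E\<^esub> \<psi>) d"
      have d': "?d \<in> ?E" "\<psi> ?d = d" using Bij_inverse[OF B(2)] d Bij_mem by auto
      then have "snd d = fe (snd ?d)"
        using g(4) unfolding covers_def by (metis snd_conv)
      then show "snd ?d = (inv\<^bsub>BijGroup (arcs G)\<^esub> fe) (snd d)"
        using Bij_inverse(2)[OF B(4)] E d' by simp
    qed
    moreover have "inv\<^bsub>?P\<^esub> g = (inv\<^bsub>BijGroup ?V\<^esub> \<phi>, inv\<^bsub>BijGroup ?E\<^esub> \<psi>)"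
      unfolding g(1) by (rule inv_DirProd) (use B in \<open>auto simp: group_BijGroup, auto simp: BijGroup_def\<close>)
    ultimately show "inv\<^bsub>?P\<^esub> g \<in> ?H"
      using C.automorphism_inverse[OF g(2)] automorphism_inverse[OF g(3)] carrier_Cov_iff by metis
  next
    fix g h assume "g \<in> ?H" "h \<in> ?H"
    then obtain \<phi> \<psi> fv fe \<phi>' \<psi>' fv' fe' where g: "g = (\<phi>, \<psi>)" "h = (\<phi>', \<psi>')"
      "(\<phi>, \<psi>) \<in> automorphisms (cover G arev x0) (cover_rev G arev x0)"
      "(\<phi>', \<psi>') \<in> automorphisms (cover G arev x0) (cover_rev G arev x0)"
      "(fv, fe) \<in> automorphisms G arev" "covers x0 (\<phi>, \<psi>) (fv, fe)"
      "(fv', fe') \<in> automorphisms G arev" "covers x0 (\<phi>', \<psi>') (fv', fe')"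
      by (cases g, cases h) (auto simp: carrier_Cov_iff)
    have B: "\<phi> \<in> Bij ?V" "\<psi> \<in> Bij ?E" "\<phi>' \<in> Bij ?V" "\<psi>' \<in> Bij ?E"
      using g(3,4) by (auto simp: automorphisms_iff)
    have "covers x0 (compose ?V \<phi> \<phi>', compose ?E \<psi> \<psi>')
        (compose (verts G) fv fv', compose (arcs G) fe fe')"
      using g(6,8) V E Bij_mem[OF B(3)] Bij_mem[OF B(4)] unfolding covers_def
      by (simp add: compose_eq)
    moreover have "g \<otimes>\<^bsub>?P\<^esub> h = (compose ?V \<phi> \<phi>', compose ?E \<psi> \<psi>')"
      using B by (simp add: g(1,2) BijGroup_def)
    ultimately show "g \<otimes>\<^bsub>?P\<^esub> h \<in> ?H"
      using C.automorphism_compose[OF g(3,4)] automorphism_compose[OF g(5,7)] carrier_Cov_iff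
      by metis
  qed
  then have "group (?P\<lparr>carrier := ?H\<rparr>)" by (rule P.subgroup_imp_group)
  then show ?thesis by (simp add: Cov_def)
qed

lemma Cov_Bij:
  assumes "g \<in> carrier (Cov G arev x0)"
  shows "fst g \<in> Bij (atoms G arev x0)" and "snd g \<in> Bij (arcs (cover G arev x0))"
proof -
  obtain \<phi> \<psi> where g: "g = (\<phi>, \<psi>)" by (cases g)
  have "(\<phi>, \<psi>) \<in> automorphisms (cover G arev x0) (cover_rev G arev x0)"
    using assms by (simp add: g carrier_Cov_iff)
  then have "\<phi> \<in> Bij (verts (cover G arev x0))" "\<psi> \<in> Bij (arcs (cover G arev x0))"
    unfolding automorphisms_iff by blast+
  then show "fst g \<in> Bij (atoms G arev x0)" "snd g \<in> Bij (arcs (cover G arev x0))"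
    by (simp_all add: g cover_def)
qed

lemma Cov_act:
  assumes "a \<in> atoms G arev x0"
  shows "g \<in> carrier (Cov G arev x0) \<Longrightarrow> fst g a \<in> atoms G arev x0"
    and "fst \<one>\<^bsub>Cov G arev x0\<^esub> a = a"
    and "g \<in> carrier (Cov G arev x0) \<Longrightarrow> h \<in> carrier (Cov G arev x0) \<Longrightarrow>
      fst (g \<otimes>\<^bsub>Cov G arev x0\<^esub> h) a = fst g (fst h a)"
proof -
  have V: "verts (cover G arev x0) = atoms G arev x0" by (simp add: cover_def)
  show "fst g a \<in> atoms G arev x0" if "g \<in> carrier (Cov G arev x0)"
    using Cov_Bij(1)[OF that] assms by (rule Bij_mem)
  show "fst \<one>\<^bsub>Cov G arev x0\<^esub> a = a"
    using assms by (simp add: Cov_def BijGroup_def V)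
  show "fst (g \<otimes>\<^bsub>Cov G arev x0\<^esub> h) a = fst g (fst h a)"
    if "g \<in> carrier (Cov G arev x0)" "h \<in> carrier (Cov G arev x0)"
    using assms Cov_Bij[OF that(1)] Cov_Bij[OF that(2)]
    by (simp add: Cov_def mult_DirProd' BijGroup_def V compose_eq)
qed


section \<open>Automorphisms act isometrically on cycles\<close>

lemma push_edge_chain:
  assumes "(fv, fe) \<in> automorphisms G arev" "e \<in> arcs G"
  shows "push fe (edge_chain arev e) = edge_chain arev (fe e)"
  using assms by (simp add: edge_chain_def linear_diff[OF linear_push] automorphisms_iff)

text \<open>
  The edge chains generate the chain space and are permuted by \<^term>\<open>push fe\<close>.
\<close>

lemma push_C1:
  assumes f: "(fv, fe) \<in> automorphisms G arev" and c: "c \<in> C1 G arev"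
  shows "push fe c \<in> C1 G arev"
proof -
  have K: "Poly_Mapping.keys c \<subseteq> arcs G" using c by (simp add: C1_def)
  have "push fe c = (\<Sum>e\<in>Poly_Mapping.keys c.
      (Poly_Mapping.lookup c e / 2) *\<^sub>R push fe (edge_chain arev e))"
    by (subst chain_eq_sum_edge_chains[OF c])
      (simp add: linear_sum[OF linear_push] linear_scale[OF linear_push])
  also have "\<dots> \<in> C1 G arev"
    using K f Bij_mem[of fe "arcs G"]
    by (intro subspace_sum[OF subspace_C1] subspace_scale[OF subspace_C1])
      (auto simp: push_edge_chain[OF f] edge_chain_C1 automorphisms_iff)
  finally show ?thesis .
qed

lemma boundary_push:
  assumes f: "(fv, fe) \<in> automorphisms G arev" and c: "c \<in> C1 G arev"
  shows "boundary G (push fe c) = push fv (boundary G c)"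
  unfolding push_def[of fe] boundary_eq_lin_ext linear_lin_ext_comp[OF linear_push]
    linear_lin_ext_comp[OF linear_lin_ext]
  using f c
  by (intro lin_ext_cong)
    (auto simp: C1_def automorphisms_iff linear_scale[OF linear_push] linear_diff[OF linear_push]
      subset_iff)

lemma push_Z1:
  assumes "(fv, fe) \<in> automorphisms G arev" "c \<in> Z1 G arev"
  shows "push fe c \<in> Z1 G arev"
  using assms push_C1 boundary_push by (simp add: Z1_def linear_0[OF linear_push])

lemma chain_inner_push_automorphism:
  assumes "(fv, fe) \<in> automorphisms G arev" "c \<in> C1 G arev" "d \<in> C1 G arev"
  shows "chain_inner (push fe c) (push fe d) = chain_inner c d"
  using assms
  by (intro chain_inner_push[of _ "arcs G"])
    (auto simp: automorphisms_iff Bij_def bij_betw_def C1_def)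

lemma Z1_C1: "c \<in> Z1 G arev \<Longrightarrow> c \<in> C1 G arev"
  by (simp add: Z1_def)

text \<open>
  Surjectivity onto the cycles is what lets orthogonality to all cycles be transported: a test
  cycle in the target is the image of a test cycle in the source.
\<close>

lemma push_Z1_surj:
  assumes f: "(fv, fe) \<in> automorphisms G arev" and w: "w \<in> Z1 G arev"
  obtains w' where "w' \<in> Z1 G arev" "push fe w' = w"
proof
  let ?h = "inv\<^bsub>BijGroup (arcs G)\<^esub> fe"
  show "push ?h w \<in> Z1 G arev" using push_Z1[OF automorphism_inverse[OF f] w] .
  have "fe \<in> Bij (arcs G)" using f by (simp add: automorphisms_iff)
  then show "push fe (push ?h w) = w"
    using w by (intro push_push_cancel Bij_inverse(3)) (auto simp: Z1_def C1_def)
qed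

text \<open>
  An isometry of the chains that maps the cycles onto themselves commutes with the orthogonal
  projection onto them.
\<close>

lemma is_cycle_proj_push:
  assumes f: "(fv, fe) \<in> automorphisms G arev" and c: "c \<in> C1 G arev"
    and z: "is_cycle_proj G arev c z"
  shows "is_cycle_proj G arev (push fe c) (push fe z)"
  unfolding is_cycle_proj_def
proof (intro conjI ballI)
  have Z: "z \<in> Z1 G arev" using z by (simp add: is_cycle_proj_def)
  show "push fe z \<in> Z1 G arev" using push_Z1[OF f Z] .
  fix w assume "w \<in> Z1 G arev"
  then obtain w' where w': "w' \<in> Z1 G arev" "push fe w' = w" using push_Z1_surj[OF f] by blast
  have "c - z \<in> C1 G arev" using subspace_diff[OF subspace_C1] c Z Z1_C1 by blast
  then have "chain_inner (push fe c - push fe z) w = chain_inner (c - z) w'"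
    using chain_inner_push_automorphism[OF f _ Z1_C1[OF w'(1)], of "c - z"] w'(2)
    by (simp add: linear_diff[OF linear_push])
  also have "\<dots> = 0" using z w'(1) by (simp add: is_cycle_proj_def)
  finally show "chain_inner (push fe c - push fe z) w = 0" .
qed

lemma is_cycle_proj_add:
  "is_cycle_proj G arev c z \<Longrightarrow> is_cycle_proj G arev c' z' \<Longrightarrow>
     is_cycle_proj G arev (c + c') (z + z')"
  using subspace_add[OF subspace_Z1]
  by (auto simp: is_cycle_proj_def add_diff_add chain_inner_left)

lemma is_cycle_proj_self: "c \<in> Z1 G arev \<Longrightarrow> is_cycle_proj G arev c c"
  by (simp add: is_cycle_proj_def chain_inner_left)

lemma is_cycle_proj_cycle_proj:
  "has_cycle_proj G arev \<Longrightarrow> c \<in> C1 G arev \<Longrightarrow> is_cycle_proj G arev c (cycle_proj G arev c)"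
  unfolding has_cycle_proj_def using cycle_proj_eq by metis


section \<open>Chains of paths\<close>

lemma path_chain_append: "path_chain arev (p @ q) = path_chain arev p + path_chain arev q"
  by (simp add: path_chain_def)

lemma path_chain_simps [simp]:
  "path_chain arev [] = 0"
  "path_chain arev (e # p) = edge_chain arev e + path_chain arev p"
  by (simp_all add: path_chain_def)

lemma path_chain_C1: "set p \<subseteq> arcs G \<Longrightarrow> path_chain arev p \<in> C1 G arev"
  by (induction p) (auto simp: subspace_0 subspace_C1 subspace_add edge_chain_C1)

lemma push_path_chain:
  assumes "(fv, fe) \<in> automorphisms G arev"
  shows "set p \<subseteq> arcs G \<Longrightarrow> push fe (path_chain arev p) = path_chain arev (map fe p)"
  by (induction p)
    (auto simp: linear_0[OF linear_push] linear_add[OF linear_push] push_edge_chain[OF assms])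

lemma boundary_path_chain:
  "awalk x p y \<Longrightarrow>
     boundary G (path_chain arev p) = Poly_Mapping.single y 1 - Poly_Mapping.single x 1"
  by (induction p arbitrary: x)
    (auto simp: awalk_simps linear_0[OF linear_boundary] linear_add[OF linear_boundary]
      boundary_edge_chain)

lemma loop_chain_Z1: "awalk x p x \<Longrightarrow> path_chain arev p \<in> Z1 G arev"
  by (auto simp: Z1_def boundary_path_chain intro!: path_chain_C1)

text \<open>
  Fix paths \<open>P v\<close> from the basepoint to \<open>v\<close> and \<open>Q v\<close> back, and let \<open>\<kappa> v\<close> be the chain of \<open>P v\<close>.
  For an edge \<open>e\<close> from \<open>s\<close> to \<open>t\<close>, the loops \<open>P s, e, Q t\<close> and \<open>P t, Q t\<close> have chains differing by
  \<open>e - (\<kappa> t - \<kappa> s)\<close>. So \<open>c - \<kappa> (\<partial> c)\<close> is in the span of the loops for every chain \<open>c\<close>, where \<open>\<kappa>\<close>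
  is extended linearly, and for a cycle this is \<open>c\<close> itself.
\<close>

lemma Z1_subset_span_loops:
  assumes conn: "Digraph_Component.connected G" and x0: "x0 \<in> verts G"
  shows "Z1 G arev \<subseteq> span {path_chain arev p | p. awalk x0 p x0}" (is "_ \<subseteq> span ?B")
proof
  have "strongly_connected G"
    using conn sym_arcs by (intro symmetric_connected_imp_strongly_connected) auto
  then have walk: "\<exists>p. awalk u p v" if "u \<in> verts G" "v \<in> verts G" for u v
    using that reachable_awalk by blast
  obtain P where P: "\<And>v. v \<in> verts G \<Longrightarrow> awalk x0 (P v) v"
    using walk[OF x0] by metis
  obtain Q where Q: "\<And>v. v \<in> verts G \<Longrightarrow> awalk v (Q v) x0"
    using walk[OF _ x0] by metis
  define \<kappa> where "\<kappa> v = path_chain arev (P v)" for v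
  fix c assume c: "c \<in> Z1 G arev"
  then have K: "Poly_Mapping.keys c \<subseteq> arcs G" by (simp add: Z1_def C1_def)
  have loop: "edge_chain arev e - (\<kappa> (head G e) - \<kappa> (tail G e)) \<in> span ?B"
    if e: "e \<in> arcs G" for e
  proof -
    let ?s = "tail G e" and ?t = "head G e"
    have "awalk x0 (P ?s @ [e] @ Q ?t) x0" "awalk x0 (P ?t @ Q ?t) x0"
      using P[of ?s] P[of ?t] Q[of ?t] e by (auto simp: awalk_Cons_iff)
    then have "path_chain arev (P ?s @ [e] @ Q ?t) - path_chain arev (P ?t @ Q ?t) \<in> span ?B"
      by (intro span_diff span_base) blast+
    then show ?thesis by (simp add: path_chain_append \<kappa>_def algebra_simps)
  qed
  have bnd: "lin_ext (\<lambda>e. (1/2) *\<^sub>R (\<kappa> (head G e) - \<kappa> (tail G e))) c = lin_ext \<kappa> (boundary G c)"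
    by (simp add: boundary_eq_lin_ext linear_lin_ext_comp[OF linear_lin_ext] lin_ext_linear)
  have "c = lin_ext (\<lambda>e. (1/2) *\<^sub>R edge_chain arev e) c"
    using chain_eq_sum_edge_chains[OF Z1_C1[OF c]] by (simp add: lin_ext_def)
  also have "\<dots> = lin_ext (\<lambda>e. (1/2) *\<^sub>R edge_chain arev e) c - lin_ext \<kappa> (boundary G c)"
    using c by (simp add: Z1_def lin_ext_linear)
  also have "\<dots> = (\<Sum>e\<in>Poly_Mapping.keys c. (Poly_Mapping.lookup c e / 2) *\<^sub>R
      (edge_chain arev e - (\<kappa> (head G e) - \<kappa> (tail G e))))"
    unfolding bnd[symmetric] unfolding lin_ext_def
    by (simp add: sum_subtractf scaleR_diff_right)
  also have "\<dots> \<in> span ?B"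
    using K loop by (intro span_sum span_scale) auto
  finally show "c \<in> span ?B" .
qed


section \<open>The action on atoms\<close>

text \<open>
  Induction along the path: an automorphism of the cover that lies over \<open>f\<close> and sends the start
  of a lifted edge to an atom \<open>a\<close> must send that edge to the lift of its image under \<open>f\<close> starting
  at \<open>a\<close>, and hence its end to the end of this lift.
\<close>

lemma Cov_acts_on_class:
  assumes g: "(\<phi>, \<psi>) \<in> automorphisms (cover G arev x0) (cover_rev G arev x0)"
    and f: "(fv, fe) \<in> automorphisms G arev" "covers x0 (\<phi>, \<psi>) (fv, fe)"
    and q: "awalk x0 q y" "\<phi> (homology_class G arev x0 []) = homology_class G arev x0 q"
    and p: "awalk x0 p x"
  shows "awalk x0 (q @ map fe p) (fv x) \<and>
    \<phi> (homology_class G arev x0 p) = homology_class G arev x0 (q @ map fe p)"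
  using p
proof (induction p arbitrary: x rule: rev_induct)
  case Nil
  then have x: "x = x0" "x0 \<in> verts G" by (auto simp: awalk_simps)
  then have "awalk x0 [] x0" by (simp add: awalk_simps)
  then have "homology_class G arev x0 [] \<in> verts (cover G arev x0)"
    "atom_vert G x0 (homology_class G arev x0 []) = x0"
    using atom_vert_class by (auto simp: cover_def atoms_def)
  \<comment> \<open>The end of the path \<open>q\<close> is forced because the automorphism of the cover lies over \<open>f\<close>.\<close>
  then have "y = fv x0"
    using f(2) q atom_vert_class[OF q(1)] by (auto simp: covers_def)
  then show ?case using q x by simp
next
  case (snoc e p)
  let ?a = "homology_class G arev x0 p"
  have e: "e \<in> arcs G" "awalk x0 p (tail G e)" "x = head G e"
    using snoc.prems by (auto simp: awalk_simps)
  have IH: "awalk x0 (q @ map fe p) (fv (tail G e))" "\<phi> ?a = homology_class G arev x0 (q @ map fe p)"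
    using snoc.IH[OF e(2)] by auto
  have fe: "fe e \<in> arcs G" "tail G (fe e) = fv (tail G e)" "head G (fe e) = fv x"
    using f(1) e Bij_mem by (auto simp: automorphisms_iff)
  \<comment> \<open>The last step of the path, lifted to the cover.\<close>
  have ae: "(?a, e) \<in> arcs (cover G arev x0)"
    using e atom_vert_class[OF e(2)] by (auto simp: cover_def atoms_def)
  have "tail (cover G arev x0) (\<psi> (?a, e)) = \<phi> ?a" "snd (\<psi> (?a, e)) = fe e"
    "head (cover G arev x0) (\<psi> (?a, e)) = \<phi> (head (cover G arev x0) (?a, e))"
    using g f(2) ae by (auto simp: automorphisms_iff covers_def cover_def)
  then have "\<psi> (?a, e) = (\<phi> ?a, fe e)"
    and "head (cover G arev x0) (\<phi> ?a, fe e) = \<phi> (head (cover G arev x0) (?a, e))"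
    by (auto simp: cover_def prod_eq_iff)
  then have "\<phi> (atom_ext G arev x0 ?a e) = atom_ext G arev x0 (\<phi> ?a) (fe e)"
    by (simp add: cover_def)
  then have "\<phi> (homology_class G arev x0 (p @ [e]))
      = homology_class G arev x0 ((q @ map fe p) @ [fe e])"
    using atom_ext_class[OF e(2,1)] IH fe atom_ext_class[of x0 "q @ map fe p" "fe e"] by simp
  moreover have "awalk x0 ((q @ map fe p) @ [fe e]) (fv x)"
    using awalk_appendI[OF IH(1), of "[fe e]"] fe arc_implies_awalk[OF fe(1)] by simp
  ultimately show ?case by simp
qed

lemma atom_pos_trivial: "atom_pos G arev (homology_class G arev x0 []) = 0"
  using cycle_proj_eq[OF is_cycle_proj_self[OF subspace_0[OF subspace_Z1]]]
  by (simp add: atom_pos_class)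

text \<open>
  The map is \<open>z \<mapsto> f\<^sub>* z + b\<close>, where \<open>b\<close> is the position of the image of the trivial class.
  It does what is required because \<open>f\<^sub>*\<close> commutes with the projection.
\<close>

lemma Cov_affine:
  assumes proj: "has_cycle_proj G arev" and x0: "x0 \<in> verts G"
    and g: "g \<in> carrier (Cov G arev x0)"
  obtains T where "affine_on (Z1 G arev) T"
    "\<And>x y. x \<in> Z1 G arev \<Longrightarrow> y \<in> Z1 G arev \<Longrightarrow> chain_dist (T x) (T y) = chain_dist x y"
    "\<And>a. a \<in> atoms G arev x0 \<Longrightarrow> T (atom_pos G arev a) = atom_pos G arev (fst g a)"
proof -
  obtain \<phi> \<psi> fv fe where gf: "g = (\<phi>, \<psi>)"
    "(\<phi>, \<psi>) \<in> automorphisms (cover G arev x0) (cover_rev G arev x0)"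
    "(fv, fe) \<in> automorphisms G arev" "covers x0 (\<phi>, \<psi>) (fv, fe)"
    using g by (cases g) (auto simp: carrier_Cov_iff)
  obtain q y where q: "awalk x0 q y" "\<phi> (homology_class G arev x0 []) = homology_class G arev x0 q"
    using Cov_act(1)[OF trivial_atom[OF x0] g] gf(1) by (auto elim: atomE)
  define b where "b = cycle_proj G arev (path_chain arev q)"
  have qb: "is_cycle_proj G arev (path_chain arev q) b"
    unfolding b_def using q by (intro is_cycle_proj_cycle_proj[OF proj] path_chain_C1) auto
  let ?T = "\<lambda>z. push fe z + b"
  show thesis
  proof
    have "linear_map_on (Z1 G arev) (push fe)"
      using push_Z1[OF gf(3)]
      by (auto simp: linear_map_on_def linear_add[OF linear_push] linear_scale[OF linear_push])
    then show "affine_on (Z1 G arev) ?T"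
      using qb unfolding affine_on_def is_cycle_proj_def by blast
  next
    fix x y assume "x \<in> Z1 G arev" "y \<in> Z1 G arev"
    then have "x - y \<in> C1 G arev" using subspace_diff[OF subspace_C1] Z1_C1 by blast
    then show "chain_dist (?T x) (?T y) = chain_dist x y"
      using chain_inner_push_automorphism[OF gf(3)]
      by (simp add: chain_dist_def flip: linear_diff[OF linear_push])
  next
    fix a assume "a \<in> atoms G arev x0"
    then obtain p x where p: "a = homology_class G arev x0 p" "awalk x0 p x" by (rule atomE)
    have pC: "set p \<subseteq> arcs G" "path_chain arev p \<in> C1 G arev"
      using p by (auto intro!: path_chain_C1)
    have "is_cycle_proj G arev (path_chain arev (q @ map fe p))
        (b + push fe (cycle_proj G arev (path_chain arev p)))"
      unfolding path_chain_append push_path_chain[OF gf(3) pC(1), symmetric]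
      by (intro is_cycle_proj_add qb is_cycle_proj_push[OF gf(3)]
          is_cycle_proj_cycle_proj[OF proj] pC)
    from cycle_proj_eq[OF this]
    show "?T (atom_pos G arev a) = atom_pos G arev (fst g a)"
      using Cov_acts_on_class[OF gf(2-4) q p(2)]
      by (simp add: p(1) gf(1) atom_pos_class add.commute)
  qed
qed

lemma atom_pos_in_Z1:
  assumes "has_cycle_proj G arev" "a \<in> atoms G arev x0"
  shows "atom_pos G arev a \<in> Z1 G arev"
proof -
  obtain p x where p: "a = homology_class G arev x0 p" "awalk x0 p x" using assms(2) by (rule atomE)
  then have "path_chain arev p \<in> C1 G arev" by (auto intro!: path_chain_C1)
  from is_cycle_proj_cycle_proj[OF assms(1) this]
  show ?thesis by (simp add: p(1) atom_pos_class is_cycle_proj_def)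
qed

text \<open>
  The projection fixes the chains of loops, so these are themselves positions of atoms.
\<close>

lemma Z1_subset_span_atom_pos:
  assumes "Digraph_Component.connected G" "x0 \<in> verts G"
  shows "Z1 G arev \<subseteq> span (atom_pos G arev ` atoms G arev x0)"
proof -
  have "path_chain arev p \<in> atom_pos G arev ` atoms G arev x0" if p: "awalk x0 p x0" for p
  proof
    show "path_chain arev p = atom_pos G arev (homology_class G arev x0 p)"
      using cycle_proj_eq[OF is_cycle_proj_self[OF loop_chain_Z1[OF p]]]
      by (simp add: atom_pos_class)
    show "homology_class G arev x0 p \<in> atoms G arev x0" using p by (auto simp: atoms_def)
  qed
  then have "span {path_chain arev p | p. awalk x0 p x0}
      \<subseteq> span (atom_pos G arev ` atoms G arev x0)"
    by (intro span_mono) auto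
  then show ?thesis using Z1_subset_span_loops[OF assms] by blast
qed

end

section \<open>The equivariant affine action\<close>

theorem theorem11:
  fixes G :: "('v, 'e) pre_digraph" and rv :: "'e \<Rightarrow> 'e" and x0 :: 'v
  assumes "bidirected_digraph G rv"
    and "Digraph_Component.connected G"
    and "bridgeless G rv"
    and "x0 \<in> verts G"
    and "has_cycle_proj G rv"
  shows "(\<exists>!\<rho>. equivariant_affine_action G rv x0 \<rho>) \<and>
         (\<forall>\<rho>. equivariant_affine_action G rv x0 \<rho> \<longrightarrow>
            (\<forall>g\<in>carrier (Cov G rv x0). affine_isometry (Z1 G rv) (\<rho> g)))"
proof -
  interpret bidirected_digraph G rv by fact
  let ?i = "atom_pos G rv" and ?A = "atoms G rv x0" and ?Z = "Z1 G rv"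
  have i: "?i ` ?A \<subseteq> ?Z" "0 \<in> ?i ` ?A" "?Z \<subseteq> span (?i ` ?A)"
  proof -
    show "?i ` ?A \<subseteq> ?Z" using atom_pos_in_Z1[OF assms(5)] by blast
    show "0 \<in> ?i ` ?A" using trivial_atom[OF assms(4)] atom_pos_trivial by (metis image_eqI)
    show "?Z \<subseteq> span (?i ` ?A)" using Z1_subset_span_atom_pos[OF assms(2,4)] .
  qed
  have "\<exists>!\<rho>. equivariant_affine_action G rv x0 \<rho>"
    unfolding equivariant_affine_action_def
  proof (rule unique_affine_action[OF group_Cov subspace_Z1 _ _ _ i])
    show "\<exists>T. affine_on ?Z T \<and> (\<forall>a\<in>?A. T (?i a) = ?i (fst g a))"
      if "g \<in> carrier (Cov G rv x0)" for g
      using Cov_affine[OF assms(5,4) that] by metis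
  qed (simp_all add: Cov_act)
  moreover have "affine_isometry ?Z (\<rho> g)"
    if \<rho>: "equivariant_affine_action G rv x0 \<rho>" and g: "g \<in> carrier (Cov G rv x0)" for \<rho> g
  proof -
    have \<rho>g: "affine_transformation ?Z (\<rho> g)" "\<And>a. a \<in> ?A \<Longrightarrow> \<rho> g (?i a) = ?i (fst g a)"
      using \<rho> g by (auto simp: equivariant_affine_action_def affine_action_def)
    then have aff: "affine_on ?Z (\<rho> g)" by (simp add: affine_transformation_def affine_on_def)
    obtain T where T: "affine_on ?Z T"
      "\<And>x y. x \<in> ?Z \<Longrightarrow> y \<in> ?Z \<Longrightarrow> chain_dist (T x) (T y) = chain_dist x y"
      "\<And>a. a \<in> ?A \<Longrightarrow> T (?i a) = ?i (fst g a)"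
      using Cov_affine[OF assms(5,4) g] by blast
    have "\<rho> g x = T x" if "x \<in> ?Z" for x
      by (rule affine_on_eqI[OF subspace_Z1 aff T(1) i _ that]) (use \<rho>g(2) T(3) in auto)
    then show ?thesis using \<rho>g(1) T(2) by (simp add: affine_isometry_def)
  qed
  ultimately show ?thesis by blast
qed

end
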